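(* Let $p$ be a prime number. The number of complex circulant Hadamard matrices of size $p$ with diagonal entries equal to $1$ is less than or equal to $\binom{2p-2}{p-1}$.
   Context: A complex Hadamard matrix of size $n$ is a matrix $H=(h_{jk})_{j,k=0,\ldots,n-1}$ all of whose entries are complex numbers of modulus $1$ and which satisfies $H^*H=nI$. It is called circulant if $h_{jk}$ depends only on $j-k$ modulo $n$. *)

theory Defs
  imports
    "HOL-Number_Theory.Cong"
    "Jordan_Normal_Form.Schur_Decomposition"
begin

definition complex_hadamard :: "nat \<Rightarrow> complex mat \<Rightarrow> bool" where
  "complex_hadamard n H \<longleftrightarrow>
     H \<in> carrier_mat n n \<and>
     (\<forall>j<n. \<forall>k<n. cmod (H $$ (j, k)) = 1) \<and>
     mat_adjoint H * H = of_nat n \<cdot>\<^sub>m 1\<^sub>m n"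

definition circulant :: "nat \<Rightarrow> complex mat \<Rightarrow> bool" where
  "circulant n H \<longleftrightarrow>
     H \<in> carrier_mat n n \<and>
     (\<forall>j<n. \<forall>k<n. \<forall>j'<n. \<forall>k'<n.
        [int j - int k = int j' - int k'] (mod int n) \<longrightarrow> H $$ (j, k) = H $$ (j', k'))"

end

theory Submission
  imports Defs "HOL-Library.Landau_Symbols"
begin

text \<open>
  A circulant matrix with unit diagonal is its first column \<open>x = (x 0, ..., x (p - 1))\<close> with
  \<open>x 0 = 1\<close>.  If it is Hadamard, then \<open>inverse (x j) = cnj (x j)\<close> and every
  Fourier coefficient of \<open>x\<close> has squared modulus \<open>p\<close>.  So \<open>x\<close> is a point of the
  torus of dimension \<open>n = p - 1\<close> at which, with \<open>y = inverse x\<close>, the Laurent polynomials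
  \<open>X k * Y k - p\<close> vanish; here \<open>X\<close> and \<open>Y\<close> are the Fourier transforms of \<open>x\<close>
  and \<open>y\<close> for \<open>\<omega>\<close> and \<open>inverse \<omega>\<close>, where \<open>\<omega>\<close> is a primitive
  \<open>p\<close>-th root of unity.  Any finite set of \<open>N\<close> common zeros of these Laurent polynomials
  satisfies \<open>N \<le> (2 * n) choose n\<close>.

  The bound compares two estimates, for large \<open>m\<close>, of the dimension of the ring of Laurent
  polynomials modulo those that vanish to order \<open>m\<close> at the \<open>N\<close> zeros.  From below: the
  jets of order less than \<open>m\<close> at the \<open>N\<close> points can be prescribed independently
  (\<open>bump_jet_independent\<close>), which gives \<open>N * ((m - 1 + n) choose n)\<close>, about
  \<open>N * m ^ n / fact n\<close>.  From above: the Laurent monomials of bidegree at most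
  \<open>(p + m, p + m)\<close> span the quotient (\<open>laurent_reduce_mod_vanishing\<close>).  Their number is
  about \<open>((2 * n) choose n) * m ^ n / fact n\<close> (\<open>card_exps_le\<close>): the binomial coefficient
  is the normalized volume of the convex hull of the root system \<open>A_n\<close>.  Dividing by
  \<open>m ^ n\<close> and letting \<open>m\<close> tend to infinity gives the claim
  (\<open>card_common_zeros_le\<close>).

  The upper estimate is where primality enters.  A Laurent polynomial of bidegree \<open>(d + 1, d + 1)\<close>
  with \<open>p \<le> d + 1\<close> has to be rewritten, modulo multiples of the given equations, in bidegree
  \<open>(d, d)\<close>.  Consider the \<open>2 * p\<close> linear forms \<open>x j, X k\<close> and their partners
  \<open>y j, Y k\<close>; a form times its partner is a constant modulo the equations.  By Chebotarev's
  theorem on the minors of the Fourier matrix of prime order, any \<open>p\<close> of the \<open>2 * p\<close>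
  forms span all linear forms (\<open>prime_root_forms_span\<close>).  Hence one can expand factors
  \<open>y l\<close> until a product of \<open>p\<close> distinct \<open>y\<close>-forms is present, and then expand a factor
  \<open>x l\<close> in the partners of those: each term contains a form together with its partner, which
  is replaced by a constant (\<open>bform_prod_reducible\<close>).
\<close>

section \<open>Linear algebra\<close>

lemma underdetermined_system:
  fixes A :: "'i \<Rightarrow> 'k \<Rightarrow> 'a::field"
  assumes "finite K" "finite I" "card K < card I"
  shows "\<exists>c. (\<exists>i\<in>I. c i \<noteq> 0) \<and> (\<forall>k\<in>K. (\<Sum>i\<in>I. c i * A i k) = 0)"
  using assms
proof (induction K arbitrary: I A rule: finite_induct)
  case empty
  then obtain i where "i \<in> I" by fastforce
  then show ?case by (intro exI[of _ "\<lambda>_. 1"]) auto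
next
  case (insert k K)
  show ?case
  proof (cases "\<forall>i\<in>I. A i k = 0")
    case True
    have "card K < card I" using insert.hyps insert.prems by simp
    from insert.IH[OF insert.prems(1) this, of A] True show ?thesis by auto
  next
    case False
    then obtain i0 where i0: "i0 \<in> I" "A i0 k \<noteq> 0" by auto
    define B where "B i l = A i l - A i k / A i0 k * A i0 l" for i l
    have "card K < card (I - {i0})" "finite (I - {i0})"
      using insert.hyps insert.prems i0 by auto
    from insert.IH[OF this(2,1), of B] obtain c where
      c: "\<exists>i\<in>I-{i0}. c i \<noteq> 0" "\<forall>l\<in>K. (\<Sum>i\<in>I-{i0}. c i * B i l) = 0" by blast
    \<comment> \<open>the pivot coefficient is chosen so that the new equation holds\<close>
    define d where "d = c(i0 := - (\<Sum>i\<in>I-{i0}. c i * A i k) / A i0 k)"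
    have eq: "(\<Sum>i\<in>I. d i * A i l) = (\<Sum>i\<in>I-{i0}. c i * B i l)" for l
    proof -
      have "(\<Sum>i\<in>I. d i * A i l) = d i0 * A i0 l + (\<Sum>i\<in>I-{i0}. c i * A i l)"
        using insert.prems(1) i0(1) by (subst sum.remove[of I i0]) (auto simp: d_def)
      also have "\<dots> = (\<Sum>i\<in>I-{i0}. c i * B i l)"
        by (simp add: B_def d_def right_diff_distrib sum_subtractf sum_distrib_right
            sum_divide_distrib mult.assoc)
      finally show ?thesis .
    qed
    have "(\<Sum>i\<in>I. d i * A i k) = 0" using i0 by (simp add: eq B_def)
    moreover have "\<exists>i\<in>I. d i \<noteq> 0" using c(1) by (auto simp: d_def)
    ultimately show ?thesis using c(2) eq by (intro exI[of _ d]) auto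
  qed
qed

text \<open>
  Duality for a square system: the rows together with \<open>l\<close> are too many to be independent, and
  the coefficient of \<open>l\<close> in a relation cannot vanish, because otherwise one row could be dropped
  without enlarging the kernel, while fewer equations than unknowns have a nontrivial solution.
\<close>

lemma forms_span:
  fixes A :: "'i \<Rightarrow> 'k \<Rightarrow> 'a::field"
  assumes fin: "finite B" "finite K" and card: "card B = card K"
    and triv: "\<And>x. (\<forall>i\<in>B. (\<Sum>k\<in>K. A i k * x k) = 0) \<Longrightarrow> \<forall>k\<in>K. x k = 0"
  shows "\<exists>c. \<forall>k\<in>K. l k = (\<Sum>i\<in>B. c i * A i k)"
proof -
  define A' where "A' i = (case i of None \<Rightarrow> l | Some i \<Rightarrow> A i)" for i
  have "card K < card (insert None (Some ` B))"
    using fin card by (subst card_insert_disjoint) (auto simp: card_image)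
  from underdetermined_system[OF fin(2) _ this, of A'] fin obtain c where
    c: "\<exists>i\<in>insert None (Some ` B). c i \<noteq> 0"
       "\<forall>k\<in>K. (\<Sum>i\<in>insert None (Some ` B). c i * A' i k) = 0" by auto
  have c2: "c None * l k + (\<Sum>i\<in>B. c (Some i) * A i k) = 0" if "k \<in> K" for k
    using c(2)[rule_format, OF that] fin by (simp add: A'_def sum.reindex)
  have "c None \<noteq> 0"
  proof
    assume 0: "c None = 0"
    then obtain i0 where i0: "i0 \<in> B" "c (Some i0) \<noteq> 0" using c(1) by auto
    have "card (B - {i0}) < card K" using card i0 fin by (metis card_Diff1_less)
    from underdetermined_system[OF _ fin(2) this, of "\<lambda>k i. A i k"] fin obtain x where
      x: "\<exists>k\<in>K. x k \<noteq> 0" "\<forall>i\<in>B-{i0}. (\<Sum>k\<in>K. x k * A i k) = 0" by auto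
    have "0 = (\<Sum>k\<in>K. (\<Sum>i\<in>B. c (Some i) * A i k) * x k)"
      using c2 0 by simp
    also have "\<dots> = (\<Sum>i\<in>B. c (Some i) * (\<Sum>k\<in>K. A i k * x k))"
      unfolding sum_distrib_right sum_distrib_left by (subst sum.swap) (simp add: mult.assoc)
    also have "\<dots> = c (Some i0) * (\<Sum>k\<in>K. A i0 k * x k)"
      using x(2) i0 fin by (subst sum.remove[of B i0]) (auto simp: mult.commute intro!: sum.neutral)
    finally have "(\<Sum>k\<in>K. A i0 k * x k) = 0" using i0 by simp
    then have "\<forall>i\<in>B. (\<Sum>k\<in>K. A i k * x k) = 0" using x(2) by (auto simp: mult.commute)
    from triv[OF this] x(1) show False by auto
  qed
  then show ?thesis using c2
    by (intro exI[of _ "\<lambda>i. - c (Some i) / c None"])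
       (auto simp: sum_divide_distrib[symmetric] sum_negf field_simps eq_neg_iff_add_eq_0)
qed

section \<open>Minors of the Fourier matrix of prime order\<close>

lemma root_power_inj:
  fixes \<omega> :: "'a::field"
  assumes p: "prime p" and \<omega>: "\<omega> ^ p = 1" "\<omega> \<noteq> 1"
  shows "inj_on (\<lambda>t. \<omega> ^ t) {..<p}"
proof -
  have aux: "\<omega> ^ d \<noteq> 1" if dp: "0 < d" "d < p" for d
  proof
    assume d: "\<omega> ^ d = 1"
    have "coprime d p" using p dp
      by (metis coprime_commute nat_dvd_not_less prime_imp_coprime_nat)
    then have "gcd d p = 1" by simp
    then obtain x y where xy: "d * x = Suc (p * y)"
      using bezout_nat[of d p] dp by auto
    have "1 = (\<omega> ^ d) ^ x" by (simp add: d)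
    also have "\<dots> = \<omega> * (\<omega> ^ p) ^ y" by (simp add: power_mult[symmetric] xy)
    finally show False using \<omega> by simp
  qed
  have \<omega>0: "\<omega> \<noteq> 0" using \<omega> p by (auto simp: power_0_left prime_gt_0_nat split: if_splits)
  have "False" if "a < b" "b < p" "\<omega> ^ a = \<omega> ^ b" for a b
  proof -
    have "\<omega> ^ a * \<omega> ^ (b - a) = \<omega> ^ (a + (b - a))" by (simp only: power_add)
    then have "\<omega> ^ a * \<omega> ^ (b - a) = \<omega> ^ a" using that by simp
    then show False using aux[of "b - a"] that \<omega>0 by simp
  qed
  then show ?thesis by (intro inj_onI) (metis lessThan_iff nat_neq_iff)
qed

text \<open>
  The divided difference of the function \<open>x ^ n\<close> at the nodes \<open>xs\<close>, that is, the complete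
  homogeneous symmetric polynomial of degree \<open>n + 1 - length xs\<close> in \<open>xs\<close>.  The recursion
  is the Leibniz rule for \<open>x * x ^ n\<close>; being free of divisions, it also makes sense when nodes
  coincide and commutes with ring homomorphisms.
\<close>

fun powdiff :: "nat \<Rightarrow> 'a::comm_ring_1 list \<Rightarrow> 'a" where
  "powdiff 0 xs = (if length xs = 1 then 1 else 0)"
| "powdiff (Suc n) [] = 0"
| "powdiff (Suc n) (x # xs) = x * powdiff n (x # xs) + powdiff n xs"

lemma powdiff_Nil [simp]: "powdiff n [] = 0" by (cases n) auto

lemma powdiff_single [simp]: "powdiff n [x] = x ^ n" by (induction n) auto

lemma powdiff_diff:
  "(x - y) * powdiff n (x # y # xs) = powdiff n (x # xs) - powdiff n (y # xs)"
proof (induction n)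
  case (Suc n)
  have "(x - y) * powdiff (Suc n) (x # y # xs)
      = x * ((x - y) * powdiff n (x # y # xs)) + (x - y) * powdiff n (y # xs)"
    by (simp add: algebra_simps)
  also have "\<dots> = powdiff (Suc n) (x # xs) - powdiff (Suc n) (y # xs)"
    unfolding Suc.IH by (simp add: algebra_simps)
  finally show ?case .
qed auto

lemma powdiff_ones: "powdiff n (replicate (Suc r) 1) = of_nat (n choose r)"
proof (induction n arbitrary: r)
  case 0
  then show ?case by (cases r) auto
next
  case (Suc n)
  show ?case using Suc[of r] Suc[of "r - 1"] by (cases r) auto
qed

lemma (in comm_ring_hom) powdiff_hom: "powdiff n (map hom xs) = hom (powdiff n xs)"
proof (induction n arbitrary: xs)
  case (Suc n)
  show ?case using Suc.IH[of xs] Suc.IH[of "tl xs"] by (cases xs) (auto simp: hom_distribs)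
qed (auto simp: hom_distribs)

text \<open>
  Divided differences at distinct nodes are linear combinations of the values there, so they
  vanish with the values.
\<close>

lemma sum_powdiff_eq_0:
  fixes c :: "nat \<Rightarrow> 'a::idom"
  assumes "\<And>x. x \<in> X \<Longrightarrow> (\<Sum>j\<in>S. c j * x ^ j) = 0"
    and "distinct xs" "set xs \<subseteq> X"
  shows "(\<Sum>j\<in>S. c j * powdiff j xs) = 0"
  using assms(2,3)
proof (induction "length xs" arbitrary: xs)
  case (Suc l)
  consider "xs = []" | x where "xs = [x]" | x y ys where "xs = x # y # ys"
    by (metis list.exhaust)
  then show ?case
  proof cases
    case 3
    have "(x - y) * (\<Sum>j\<in>S. c j * powdiff j xs)
        = (\<Sum>j\<in>S. c j * powdiff j (x # ys)) - (\<Sum>j\<in>S. c j * powdiff j (y # ys))"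
      unfolding 3 by (simp add: sum_distrib_left mult.left_commute[of "x - y"] powdiff_diff
          right_diff_distrib sum_subtractf)
    also have "\<dots> = 0" using Suc 3 by auto
    finally show ?thesis using Suc.prems 3 by auto
  qed (use Suc assms in auto)
qed auto

text \<open>
  Multiplying by \<open>x - s\<close> stays in the integer span of the binomial coefficients because
  \<open>x * (x choose r) = r * (x choose r) + (r + 1) * (x choose (r + 1))\<close>.
\<close>

lemma newton_binomial_basis:
  fixes ss :: "nat \<Rightarrow> nat"
  shows "\<exists>b :: nat \<Rightarrow> int. \<forall>x. (\<Prod>i<k. int x - int (ss i)) = (\<Sum>r\<le>k. b r * int (x choose r))"
proof (induction k)
  case 0
  show ?case by (intro exI[of _ "\<lambda>_. 1"]) auto
next
  case (Suc k)
  then obtain b :: "nat \<Rightarrow> int" where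
    b: "\<And>x. (\<Prod>i<k. int x - int (ss i)) = (\<Sum>r\<le>k. b r * int (x choose r))" by blast
  define b' where "b' r = (if r \<le> k then (int r - int (ss k)) * b r else 0)
    + (case r of 0 \<Rightarrow> 0 | Suc r' \<Rightarrow> int r * b r')" for r
  have "(\<Prod>i<Suc k. int x - int (ss i)) = (\<Sum>r\<le>Suc k. b' r * int (x choose r))" for x
  proof -
    have step: "int x * int (x choose r) = int r * int (x choose r)
        + int (Suc r) * int (x choose Suc r)" for r
    proof -
      have "x * (x choose r) = r * (x choose r) + Suc r * (x choose Suc r)"
      proof (cases "r \<le> x")
        case True
        have "(x - r) * (x choose r) = Suc r * (x choose Suc r)"
          by (simp only: binomial_absorb_comp binomial_absorption)
        with True show ?thesis by (metis add_mult_distrib le_add_diff_inverse)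
      qed (auto simp: binomial_eq_0)
      then show ?thesis by (metis of_nat_add of_nat_mult)
    qed
    have "(\<Prod>i<Suc k. int x - int (ss i)) = (\<Sum>r\<le>k. b r * ((int x - int (ss k)) * int (x choose r)))"
      using b[of x] by (simp add: sum_distrib_right sum_distrib_left mult_ac)
    also have "\<dots> = (\<Sum>r\<le>k. (int r - int (ss k)) * b r * int (x choose r)
        + int (Suc r) * b r * int (x choose Suc r))"
      by (intro sum.cong refl) (simp add: left_diff_distrib step del: of_nat_Suc, simp add: algebra_simps)
    also have "\<dots> = (\<Sum>r\<le>Suc k. b' r * int (x choose r))"
    proof -
      have "(\<Sum>r\<le>Suc k. (case r of 0 \<Rightarrow> 0 | Suc r' \<Rightarrow> int r * b r') * int (x choose r))
          = (\<Sum>r\<le>k. int (Suc r) * b r * int (x choose Suc r))"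
        by (subst sum.atMost_Suc_shift) (simp del: of_nat_Suc)
      then show ?thesis
        unfolding b'_def distrib_right sum.distrib by (simp del: of_nat_Suc binomial_Suc_Suc)
    qed
    finally show ?thesis .
  qed
  then show ?case by blast
qed


text \<open>
  An integer change of basis to Newton polynomials turns the matrix into a triangular one whose
  diagonal entries are products of differences of the \<open>ss i\<close>.  The base change matrix need
  not be invertible over the integers: \<open>p\<close> not dividing the product of two determinants is enough.
\<close>

lemma coprime_det_binomial:
  fixes ss :: "nat \<Rightarrow> nat"
  assumes p: "prime p" and ss: "\<And>i. i < s \<Longrightarrow> ss i < p" and inj: "inj_on ss {..<s}"
  shows "\<not> int p dvd det (mat s s (\<lambda>(r, j). int (ss j choose r)))"
proof
  define A where "A = mat s s (\<lambda>(r, j). int (ss j choose r))"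
  assume "int p dvd det (mat s s (\<lambda>(r, j). int (ss j choose r)))"
  then have dvd: "int p dvd det A" by (simp add: A_def)
  obtain b :: "nat \<Rightarrow> nat \<Rightarrow> int" where
    b: "\<And>k x. (\<Prod>i<k. int x - int (ss i)) = (\<Sum>r\<le>k. b k r * int (x choose r))"
    using newton_binomial_basis[where ss = ss] by metis
  define B where "B = mat s s (\<lambda>(k, r). if r \<le> k then b k r else 0)"
  have car: "A \<in> carrier_mat s s" "B \<in> carrier_mat s s" by (auto simp: A_def B_def)
  have entry: "(B * A) $$ (k, j) = (\<Prod>i<k. int (ss j) - int (ss i))" if "k < s" "j < s" for k j
  proof -
    have "(B * A) $$ (k, j) = (\<Sum>r<s. if r \<le> k then b k r * int (ss j choose r) else 0)"
      using that car by (auto simp: A_def B_def scalar_prod_def lessThan_atLeast0 intro!: sum.cong)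
    also have "\<dots> = (\<Sum>r\<le>k. b k r * int (ss j choose r))"
      using that by (intro sum.mono_neutral_cong_right) auto
    finally show ?thesis by (simp add: b)
  qed
  have "det (B * A) = prod_list (diag_mat (B * A))"
    using car by (intro det_upper_triangular[of _ s] upper_triangularI)
      (auto simp: entry simp del: index_mult_mat(1))
  also have "\<dots> = (\<Prod>k<s. \<Prod>i<k. int (ss k) - int (ss i))"
    using car by (auto simp: prod_list_diag_prod lessThan_atLeast0 entry
        simp del: index_mult_mat(1) intro!: prod.cong)
  finally have det: "det B * det A = (\<Prod>k<s. \<Prod>i<k. int (ss k) - int (ss i))"
    using det_mult[OF car(2,1)] by simp
  have "int p dvd (\<Prod>k<s. \<Prod>i<k. int (ss k) - int (ss i))"
    using dvd by (simp flip: det)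
  moreover have "prime (int p)" using p by simp
  ultimately obtain k i where ki: "k < s" "i < k" "int p dvd int (ss k) - int (ss i)"
    by (auto simp: prime_dvd_prod_iff)
  then have "ss k \<noteq> ss i" using inj by (auto dest: inj_onD)
  moreover have "ss k < p" "ss i < p" using ss ki by auto
  ultimately show False using ki(3) by (auto dest!: dvd_imp_le_int[rotated])
qed

lemma comm_ring_hom_eval_int_poly:
  "comm_ring_hom (\<lambda>g. poly (map_poly of_int g) (x :: 'a::comm_ring_1))"
  by unfold_locales (auto simp: hom_distribs)

text \<open>
  Multiplication by \<open>g\<close> modulo \<open>X ^ p - 1\<close> is an integer matrix having the value
  \<open>g(\<omega>)\<close> as an eigenvalue with eigenvector \<open>(1, \<omega>, \<omega> ^ 2, ...)\<close>.
\<close>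

lemma algebraic_int_eval_root_of_unity:
  fixes \<omega> :: "'a::field_char_0"
  assumes p: "p > 0" and \<omega>: "\<omega> ^ p = 1"
  shows "algebraic_int (poly (map_poly of_int g) \<omega>)"
proof -
  define A where "A = mat p p (\<lambda>(i, k). \<Sum>m\<le>degree g. if (m + i) mod p = k then coeff g m else 0)"
  define v where "v = vec p (\<lambda>k. \<omega> ^ k)"
  define z where "z = poly (map_poly of_int g) \<omega>"
  have A: "A \<in> carrier_mat p p" by (simp add: A_def)
  then have A': "map_mat of_int A \<in> carrier_mat p p" by simp
  have mod: "\<omega> ^ (k mod p) = \<omega> ^ k" for k
  proof -
    have "\<omega> ^ k = \<omega> ^ (p * (k div p) + k mod p)" by simp
    also have "\<dots> = \<omega> ^ (k mod p)" unfolding power_add power_mult \<omega> by simp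
    finally show ?thesis by simp
  qed
  have "(map_mat of_int A *\<^sub>v v) $ i = (z \<cdot>\<^sub>v v) $ i" if "i < p" for i
  proof -
    have "(map_mat of_int A *\<^sub>v v) $ i
        = (\<Sum>k<p. (\<Sum>m\<le>degree g. if (m + i) mod p = k then of_int (coeff g m) else 0) * \<omega> ^ k)"
      using that by (auto simp: A_def v_def scalar_prod_def lessThan_atLeast0 if_distrib[of of_int]
          cong: if_cong intro!: sum.cong)
    also have "\<dots> = (\<Sum>m\<le>degree g. \<Sum>k<p. if (m + i) mod p = k then of_int (coeff g m) * \<omega> ^ k else 0)"
      unfolding sum_distrib_right by (subst sum.swap) (auto intro!: sum.cong)
    also have "\<dots> = (\<Sum>m\<le>degree g. of_int (coeff g m) * \<omega> ^ (m + i))"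
      using p by (simp add: mod)
    also have "\<dots> = z * \<omega> ^ i"
      by (simp add: z_def poly_altdef sum_distrib_right power_add mult.assoc)
    finally show ?thesis using that by (simp add: v_def)
  qed
  then have "map_mat of_int A *\<^sub>v v = z \<cdot>\<^sub>v v" using A by (intro eq_vecI) (auto simp: v_def)
  moreover have "v \<noteq> 0\<^sub>v p"
  proof
    assume "v = 0\<^sub>v p"
    then have "v $ 0 = 0" using p by simp
    then show False using p by (simp add: v_def)
  qed
  ultimately have "eigenvector (map_mat of_int A) v z"
    using A by (auto simp: eigenvector_def v_def)
  then have "eigenvalue (map_mat of_int A) z" by (auto simp: eigenvalue_def)
  then have "poly (char_poly (map_mat of_int A)) z = 0"
    by (simp add: eigenvalue_root_char_poly[OF A'])
  then have "poly (map_poly of_int (char_poly A)) z = 0"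
    by (simp add: of_int_hom.char_poly_hom[OF A])
  moreover have "lead_coeff (char_poly A) = 1" using degree_monic_char_poly[OF A] by simp
  ultimately show ?thesis unfolding z_def algebraic_int_altdef_ipoly by blast
qed

text \<open>
  If \<open>g(1)\<close> were prime to \<open>p\<close>, then \<open>g(\<omega>) = 0\<close> would put \<open>1\<close> into the ideal generated by
  \<open>p\<close> and \<open>\<omega> - 1\<close>.  As \<open>p\<close> divides \<open>(\<omega> - 1) ^ p\<close> in the ring
  generated by \<open>\<omega>\<close>, the integer \<open>p\<close> would be a unit of that ring, but \<open>1 / p\<close>
  is not an algebraic integer.
\<close>

lemma vanishing_at_root_of_unity_imp_dvd:
  fixes \<omega> :: complex
  assumes p: "prime p" and \<omega>: "\<omega> ^ p = 1" and g: "poly (map_poly of_int g) \<omega> = 0"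
  shows "int p dvd poly g 1"
proof (rule ccontr)
  assume ndvd: "\<not> int p dvd poly g 1"
  interpret H: comm_ring_hom "\<lambda>g. poly (map_poly of_int g) \<omega>"
    by (rule comm_ring_hom_eval_int_poly)
  let ?H = "\<lambda>g. poly (map_poly of_int g) \<omega>"
  let ?P = "[:int p:]" and ?\<pi> = "[:-1, 1:] :: int poly"
  have "coprime (int p) (poly g 1)" using p ndvd by (simp add: prime_imp_coprime)
  then obtain a b where ab: "a * poly g 1 + b * int p = 1"
    by (metis add.commute bezout_int coprime_imp_gcd_eq_1 mult.commute)
  have "?\<pi> dvd ([:poly g 1:] - g)" by (simp add: dvd_iff_poly_eq_0)
  then obtain r where r: "[:poly g 1:] - g = ?\<pi> * r" by (elim dvdE)
  define z where "z = [:a:] * r"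
  define d where "d = [:a:] * g + [:b:] * ?P"
  have d: "d = 1 - ?\<pi> * z"
  proof -
    have "1 = [:a * poly g 1 + b * int p:]" by (simp add: ab)
    also have "\<dots> = [:a:] * [:poly g 1:] + [:b:] * ?P" by simp
    also have "[:poly g 1:] = g + ?\<pi> * r" unfolding r[symmetric] by simp
    finally show ?thesis unfolding d_def z_def by (simp only: algebra_simps)
  qed
  define s where "s = (\<Sum>i<p. (?\<pi> * z) ^ i)"
  \<comment> \<open>telescoping: \<open>d = 1 - \<pi> * z\<close> divides \<open>1 - (\<pi> * z) ^ p\<close>\<close>
  have ds: "d * s = 1 - ?\<pi> ^ p * z ^ p"
    unfolding d s_def by (simp only: one_diff_power_eq[symmetric] power_mult_distrib)
  have "?P dvd monom 1 p - 1 - ?\<pi> ^ p"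
  proof -
    have "monom 1 p = (?\<pi> + 1) ^ p" by (simp add: monom_altdef one_pCons)
    also have "\<dots> = (\<Sum>k\<le>p. of_nat (p choose k) * ?\<pi> ^ k)" by (simp add: binomial_ring)
    also have "{..p} = insert 0 (insert p {0<..<p})" using p by (auto simp: prime_gt_0_nat)
    also have "(\<Sum>k\<in>\<dots>. of_nat (p choose k) * ?\<pi> ^ k)
        = 1 + ?\<pi> ^ p + (\<Sum>k\<in>{0<..<p}. of_nat (p choose k) * ?\<pi> ^ k)"
      using p by (simp add: prime_gt_0_nat)
    finally have eq: "monom 1 p - 1 - ?\<pi> ^ p = (\<Sum>k\<in>{0<..<p}. of_nat (p choose k) * ?\<pi> ^ k)"
      by simp
    have "?P dvd of_nat (p choose k) * ?\<pi> ^ k" if "k \<in> {0<..<p}" for k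
    proof -
      have "p dvd p choose k" using p that by (intro dvd_choose_prime) auto
      then obtain q where "p choose k = p * q" by (elim dvdE)
      then have "of_nat (p choose k) * ?\<pi> ^ k = ?P * (of_nat q * ?\<pi> ^ k)"
        by (simp add: of_nat_poly mult.commute)
      then show ?thesis by (metis dvd_triv_left)
    qed
    then show ?thesis unfolding eq by (intro dvd_sum) auto
  qed
  then obtain V where V: "monom 1 p - 1 - ?\<pi> ^ p = ?P * V" by (elim dvdE)
  have "1 = d * s + ?\<pi> ^ p * z ^ p" by (simp add: ds)
  also have "?\<pi> ^ p = monom 1 p - 1 - ?P * V" unfolding V[symmetric] by simp
  finally have "1 = [:a:] * g * s + (monom 1 p - 1) * z ^ p + ?P * ([:b:] * s - V * z ^ p)"
    unfolding d_def by (simp only: algebra_simps)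
  then have "?H 1 = ?H ([:a:] * g * s + (monom 1 p - 1) * z ^ p + ?P * ([:b:] * s - V * z ^ p))"
    by (simp only:)
  also have "\<dots> = ?H [:a:] * ?H g * ?H s + (?H (monom 1 p) - ?H 1) * ?H z ^ p
      + ?H ?P * ?H ([:b:] * s - V * z ^ p)"
    by (simp only: H.hom_add H.hom_mult H.hom_minus H.hom_power)
  also have "?H ?P = of_nat p" by (simp add: hom_distribs)
  also have "?H [:a:] * ?H g * ?H s + (?H (monom 1 p) - ?H 1) * ?H z ^ p
      + of_nat p * ?H ([:b:] * s - V * z ^ p) = of_nat p * ?H ([:b:] * s - V * z ^ p)"
    using g \<omega> by (simp add: poly_monom)
  finally have "?H ([:b:] * s - V * z ^ p) = of_rat (1 / of_nat p)"
    using p by (simp add: field_simps of_rat_divide prime_gt_0_nat)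
  moreover have "algebraic_int (?H ([:b:] * s - V * z ^ p))"
    using p \<omega> by (intro algebraic_int_eval_root_of_unity[of p]) (auto simp: prime_gt_0_nat)
  ultimately have "(of_rat (1 / of_nat p) :: complex) \<in> \<int>"
    by (intro rational_algebraic_int_is_int) auto
  then obtain n where "(of_rat (1 / of_nat p) :: complex) = of_int n" by (elim Ints_cases)
  then have "(of_int (n * int p) :: complex) = of_int 1"
    using p by (simp add: field_simps of_rat_divide prime_gt_0_nat)
  then have "n * int p = 1" by (simp only: of_int_eq_iff)
  then have "int p dvd 1" by (metis dvd_triv_right)
  then show False using p by auto
qed

text \<open>
  Chebotarev's theorem in the form of an uncertainty principle.  Evaluation at the nodes
  \<open>\<omega> ^ t\<close> is replaced by divided differences.  Their matrix comes from a matrix over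
  the polynomial ring \<open>\<int>[Y]\<close> by \<open>Y = \<omega>\<close>, and its determinant, unlike that of
  the evaluation matrix, stays prime to \<open>p\<close> at \<open>Y = 1\<close>, where the entries become
  binomial coefficients.
\<close>

theorem chebotarev_vanishing:
  fixes \<omega> :: complex
  assumes p: "prime p" and \<omega>: "\<omega> ^ p = 1" "\<omega> \<noteq> 1"
    and S: "S \<subseteq> {..<p}" and T: "T \<subseteq> {..<p}" and card: "card S \<le> card T"
    and zero: "\<And>t. t \<in> T \<Longrightarrow> (\<Sum>j\<in>S. c j * \<omega> ^ (t * j)) = 0"
  shows "\<forall>j\<in>S. c j = 0"
proof (rule ccontr)
  assume nz: "\<not> (\<forall>j\<in>S. c j = 0)"
  define s where "s = card S"
  have fin: "finite S" "finite T" using S T finite_subset by blast+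
  obtain T' where T': "T' \<subseteq> T" "card T' = s" "finite T'"
    using obtain_subset_with_card_n[OF card] fin s_def by (metis finite_subset)
  define ts where "ts = sorted_list_of_set T'"
  define ss where "ss j = sorted_list_of_set S ! j" for j
  have ts: "distinct ts" "set ts = T'" "length ts = s" using T' by (auto simp: ts_def)
  have bij: "bij_betw ss {..<s} S"
    unfolding ss_def s_def using fin by (intro bij_betw_nth) auto
  interpret H: comm_ring_hom "\<lambda>g. poly (map_poly of_int g) \<omega>"
    by (rule comm_ring_hom_eval_int_poly)
  have E: "comm_ring_hom (\<lambda>g :: int poly. poly g 1)"
    by unfold_locales auto
  let ?H = "\<lambda>g. poly (map_poly of_int g) \<omega>"
  define M where "M = mat s s (\<lambda>(r, j). powdiff (ss j) (map (monom (1::int)) (take (Suc r) ts)))"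
  have M: "M \<in> carrier_mat s s" by (simp add: M_def)
  define v where "v = vec s (\<lambda>j. c (ss j))"
  have "(map_mat ?H M *\<^sub>v v) $ r = 0" if "r < s" for r
  proof -
    let ?xs = "map (\<lambda>t. \<omega> ^ t) (take (Suc r) ts)"
    have sub: "set (take (Suc r) ts) \<subseteq> T'" using ts set_take_subset by fastforce
    have xs: "map ?H (map (monom (1::int)) (take (Suc r) ts)) = ?xs"
      by (simp add: poly_monom)
    have "(map_mat ?H M *\<^sub>v v) $ r = (\<Sum>j<s. powdiff (ss j) ?xs * c (ss j))"
      using that by (auto simp: M_def v_def scalar_prod_def lessThan_atLeast0 xs
          H.powdiff_hom[symmetric] simp del: map_map intro!: sum.cong)
    also have "\<dots> = (\<Sum>j\<in>S. c j * powdiff j ?xs)"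
      by (subst sum.reindex_bij_betw[OF bij, symmetric]) (simp add: mult.commute)
    also have "\<dots> = 0"
    proof (rule sum_powdiff_eq_0[of "(\<lambda>t. \<omega> ^ t) ` T"])
      have "inj_on (\<lambda>t. \<omega> ^ t) (set (take (Suc r) ts))"
        by (rule inj_on_subset[OF root_power_inj[OF p \<omega>]]) (use sub T' T in auto)
      then show "distinct ?xs" using ts by (simp add: distinct_map)
      show "set ?xs \<subseteq> (\<lambda>t. \<omega> ^ t) ` T" using sub T' by auto
    qed (use zero in \<open>auto simp: power_mult\<close>)
    finally show ?thesis .
  qed
  then have "map_mat ?H M *\<^sub>v v = 0\<^sub>v s" using M by (intro eq_vecI) auto
  moreover have "v \<noteq> 0\<^sub>v s"
  proof
    assume v0: "v = 0\<^sub>v s"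
    have "c (ss j) = 0" if "j < s" for j
    proof -
      have "v $ j = 0" using v0 that by simp
      then show ?thesis using that by (simp add: v_def)
    qed
    then show False using nz bij by (auto simp: bij_betw_def)
  qed
  moreover have "v \<in> carrier_vec s" by (simp add: v_def)
  ultimately have "det (map_mat ?H M) = 0"
    using M by (subst det_0_iff_vec_prod_zero[of _ s]) auto
  then have "?H (det M) = 0" by simp
  then have "int p dvd poly (det M) 1"
    by (rule vanishing_at_root_of_unity_imp_dvd[OF p \<omega>(1)])
  also have "poly (det M) 1 = det (map_mat (\<lambda>g. poly g 1) M)" by (rule comm_ring_hom.hom_det[OF E, symmetric])
  also have "map_mat (\<lambda>g. poly g 1) M = mat s s (\<lambda>(r, j). int (ss j choose r))"
  proof (rule eq_matI)
    fix r j assume rj: "r < dim_row (mat s s (\<lambda>(r, j). int (ss j choose r)))"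
      "j < dim_col (mat s s (\<lambda>(r, j). int (ss j choose r)))"
    have "map (\<lambda>g. poly g 1) (map (monom (1::int)) (take (Suc r) ts)) = replicate (Suc r) 1"
      using rj ts by (intro nth_equalityI) (auto simp: poly_monom simp del: replicate_Suc)
    then show "map_mat (\<lambda>g. poly g 1) M $$ (r, j) = mat s s (\<lambda>(r, j). int (ss j choose r)) $$ (r, j)"
      using rj by (simp add: M_def comm_ring_hom.powdiff_hom[OF E, symmetric] powdiff_ones del: map_map replicate_Suc)
  qed (auto simp: M_def)
  finally show False
    using coprime_det_binomial[OF p, of s ss] bij S by (auto simp: bij_betw_def)
qed

section \<open>Laurent polynomials filtered by bidegree\<close>

text \<open>
  The normalisation \<open>x 0 = 1\<close> makes \<open>n\<close> the dimension of the torus while index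
  \<open>0\<close> remains available as the constant coordinate.
\<close>

definition torus :: "nat \<Rightarrow> (nat \<Rightarrow> complex) set" where
  "torus n = {x. x 0 = 1 \<and> (\<forall>i\<in>{1..n}. x i \<noteq> 0)}"

text \<open>
  Exponents of Laurent monomials whose numerator has degree at most \<open>a\<close> and whose denominator
  has degree at most \<open>b\<close>.
\<close>

definition exps :: "nat \<Rightarrow> nat \<Rightarrow> nat \<Rightarrow> (nat \<Rightarrow> int) set" where
  "exps n a b = {e. (\<forall>i. i \<notin> {1..n} \<longrightarrow> e i = 0) \<and>
     (\<Sum>i=1..n. nat (e i)) \<le> a \<and> (\<Sum>i=1..n. nat (- e i)) \<le> b}"

definition lmono :: "nat \<Rightarrow> (nat \<Rightarrow> int) \<Rightarrow> (nat \<Rightarrow> complex) \<Rightarrow> complex" where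
  "lmono n e x = (\<Prod>i=1..n. x i powi e i)"

text \<open>
  Laurent polynomials are represented by functions whose values outside the torus are arbitrary;
  for this reason the lemmas below compare functions on the torus only.
\<close>

definition laurent :: "nat \<Rightarrow> nat \<Rightarrow> nat \<Rightarrow> ((nat \<Rightarrow> complex) \<Rightarrow> complex) set" where
  "laurent n a b = {f. \<exists>c. \<forall>x\<in>torus n. f x = (\<Sum>e\<in>exps n a b. c e * lmono n e x)}"

lemma finite_exps [simp]: "finite (exps n a b)"
proof (rule finite_subset)
  show "exps n a b \<subseteq> {f. \<forall>x. (x \<in> {1..n} \<longrightarrow> f x \<in> {- int b..int a}) \<and> (x \<notin> {1..n} \<longrightarrow> f x = 0)}"
  proof (intro subsetI CollectI allI conjI impI)
    fix e i assume e: "e \<in> exps n a b" and i: "i \<in> {1..n}"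
    have "nat (e i) \<le> (\<Sum>i=1..n. nat (e i))" "nat (- e i) \<le> (\<Sum>i=1..n. nat (- e i))"
      using i by (auto intro: member_le_sum)
    then have "nat (e i) \<le> a" "nat (- e i) \<le> b" using e by (auto simp: exps_def)
    then show "e i \<in> {- int b..int a}" by auto
  qed (auto simp: exps_def)
  show "finite {f. \<forall>x. (x \<in> {1..n} \<longrightarrow> f x \<in> {- int b..int a}) \<and> (x \<notin> {1..n} \<longrightarrow> f x = 0)}"
    by (rule finite_set_of_finite_funs) auto
qed

lemma laurent_cong:
  "f \<in> laurent n a b \<Longrightarrow> (\<And>x. x \<in> torus n \<Longrightarrow> g x = f x) \<Longrightarrow> g \<in> laurent n a b"
  by (auto simp: laurent_def)

lemma laurent_zero [intro]: "(\<lambda>x. 0) \<in> laurent n a b"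
  unfolding laurent_def by (auto intro!: exI[of _ "\<lambda>_. 0"])

lemma laurent_lmono: "e \<in> exps n a b \<Longrightarrow> lmono n e \<in> laurent n a b"
  unfolding laurent_def
  by (auto intro!: exI[of _ "\<lambda>e'. if e' = e then 1 else 0"] simp: if_distrib[of "\<lambda>z. z * _"] cong: if_cong)

lemma laurent_add [intro]:
  assumes "f \<in> laurent n a b" "g \<in> laurent n a b"
  shows "(\<lambda>x. f x + g x) \<in> laurent n a b"
proof -
  from assms obtain c d where
    "\<forall>x\<in>torus n. f x = (\<Sum>e\<in>exps n a b. c e * lmono n e x)"
    "\<forall>x\<in>torus n. g x = (\<Sum>e\<in>exps n a b. d e * lmono n e x)" by (auto simp: laurent_def)
  then show ?thesis unfolding laurent_def
    by (auto intro!: exI[of _ "\<lambda>e. c e + d e"] simp: sum.distrib distrib_right)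
qed

lemma laurent_scale [intro]:
  assumes "f \<in> laurent n a b"
  shows "(\<lambda>x. k * f x) \<in> laurent n a b"
proof -
  from assms obtain c where
    "\<forall>x\<in>torus n. f x = (\<Sum>e\<in>exps n a b. c e * lmono n e x)" by (auto simp: laurent_def)
  then show ?thesis unfolding laurent_def
    by (auto intro!: exI[of _ "\<lambda>e. k * c e"] simp: sum_distrib_left mult.assoc)
qed

lemma laurent_diff [intro]:
  assumes "f \<in> laurent n a b" "g \<in> laurent n a b"
  shows "(\<lambda>x. f x - g x) \<in> laurent n a b"
  using laurent_add[OF assms(1) laurent_scale[OF assms(2), of "-1"]] by simp

lemma laurent_sum [intro]:
  assumes "\<And>i. i \<in> I \<Longrightarrow> f i \<in> laurent n a b"
  shows "(\<lambda>x. \<Sum>i\<in>I. f i x) \<in> laurent n a b"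
  using assms by (induction I rule: infinite_finite_induct) auto

lemma laurent_induct [consumes 1, case_names cong zero add scale lmono]:
  assumes f: "f \<in> laurent n a b"
    and cong: "\<And>f g. Q f \<Longrightarrow> (\<And>x. x \<in> torus n \<Longrightarrow> g x = f x) \<Longrightarrow> Q g"
    and zero: "Q (\<lambda>x. 0)"
    and add: "\<And>f g. Q f \<Longrightarrow> Q g \<Longrightarrow> Q (\<lambda>x. f x + g x)"
    and scale: "\<And>c f. Q f \<Longrightarrow> Q (\<lambda>x. c * f x)"
    and mono: "\<And>e. e \<in> exps n a b \<Longrightarrow> Q (lmono n e)"
  shows "Q f"
proof -
  from f obtain c where c: "\<And>x. x \<in> torus n \<Longrightarrow> f x = (\<Sum>e\<in>exps n a b. c e * lmono n e x)"
    by (auto simp: laurent_def)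
  have "Q (\<lambda>x. \<Sum>e\<in>E. c e * lmono n e x)" if "finite E" "E \<subseteq> exps n a b" for E
    using that
  proof (induction E rule: finite_induct)
    case (insert e E)
    then show ?case using add[OF scale[OF mono, of e "c e"], of "\<lambda>x. \<Sum>e\<in>E. c e * lmono n e x"] by simp
  qed (simp add: zero)
  from cong[OF this[OF finite_exps order_refl]] c show ?thesis by simp
qed

lemma laurent_mono_le:
  assumes "f \<in> laurent n a b" "a \<le> a'" "b \<le> b'"
  shows "f \<in> laurent n a' b'"
  using assms(1)
proof (induction rule: laurent_induct)
  case (lmono e)
  then show ?case using assms by (intro laurent_lmono) (auto simp: exps_def)
qed (auto intro: laurent_cong)

lemma exps_add:
  assumes "e \<in> exps n a b" "e' \<in> exps n a' b'"
  shows "(\<lambda>i. e i + e' i) \<in> exps n (a + a') (b + b')"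
proof -
  have "(\<Sum>i=1..n. nat (e i + e' i)) \<le> (\<Sum>i=1..n. nat (e i)) + (\<Sum>i=1..n. nat (e' i))"
    "(\<Sum>i=1..n. nat (- (e i + e' i))) \<le> (\<Sum>i=1..n. nat (- e i)) + (\<Sum>i=1..n. nat (- e' i))"
    unfolding sum.distrib[symmetric] by (intro sum_mono; linarith)+
  then show ?thesis using assms by (fastforce simp: exps_def)
qed

lemma lmono_add:
  "x \<in> torus n \<Longrightarrow> lmono n (\<lambda>i. e i + e' i) x = lmono n e x * lmono n e' x"
  unfolding lmono_def prod.distrib[symmetric]
  by (intro prod.cong) (auto simp: torus_def power_int_add)

lemma laurent_mult:
  assumes f: "f \<in> laurent n a b" and g: "g \<in> laurent n a' b'"
  shows "(\<lambda>x. f x * g x) \<in> laurent n (a + a') (b + b')"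
  using f
proof (induction rule: laurent_induct)
  case (lmono e)
  from g show ?case
  proof (induction rule: laurent_induct)
    case (cong f g)
    from cong(1) show ?case by (rule laurent_cong) (simp add: cong)
  next
    case (add f g)
    then show ?case by (auto simp: distrib_left)
  next
    case (scale c f)
    from laurent_scale[OF this, of c] show ?case by (simp add: mult_ac)
  next
    case (lmono e')
    show ?case
      by (rule laurent_cong[OF laurent_lmono[OF exps_add[OF \<open>e \<in> _\<close> lmono]]])
        (simp add: lmono_add)
  qed auto
next
  case (cong f g)
  from cong(1) show ?case by (rule laurent_cong) (simp add: cong)
next
  case (add f g)
  then show ?case by (auto simp: distrib_right)
next
  case (scale c f)
  from laurent_scale[OF this, of c] show ?case by (simp add: mult_ac)
qed auto

lemma laurent_const [intro]: "(\<lambda>x. c) \<in> laurent n a b"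
proof -
  have "lmono n (\<lambda>_. 0) \<in> laurent n a b" by (intro laurent_lmono) (auto simp: exps_def)
  from laurent_scale[OF this, of c] show ?thesis by (simp add: lmono_def)
qed

lemma laurent_coord:
  assumes "l \<le> n"
  shows "(\<lambda>x. x l) \<in> laurent n 1 0"
proof (cases "l = 0")
  case True
  show ?thesis by (rule laurent_cong[OF laurent_const[of 1]]) (simp add: True torus_def)
next
  case False
  define e where "e i = (if i = l then 1 else 0 :: int)" for i
  have "(\<Sum>i=1..n. nat (e i)) = (\<Sum>i=1..n. if i = l then 1 else 0)" by (intro sum.cong) (auto simp: e_def)
  then have e: "e \<in> exps n 1 0" using False assms by (auto simp: exps_def e_def)
  have "x l = lmono n e x" for x
    using False assms by (simp add: lmono_def e_def if_distrib[of "\<lambda>k. _ powi k"] prod.delta cong: if_cong)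
  then show ?thesis by (intro laurent_cong[OF laurent_lmono[OF e]])
qed

lemma laurent_inverse_coord:
  assumes "l \<le> n"
  shows "(\<lambda>x. inverse (x l)) \<in> laurent n 0 1"
proof (cases "l = 0")
  case True
  show ?thesis by (rule laurent_cong[OF laurent_const[of 1]]) (simp add: True torus_def)
next
  case False
  define e where "e i = (if i = l then -1 else 0 :: int)" for i
  have "(\<Sum>i=1..n. nat (- e i)) = (\<Sum>i=1..n. if i = l then 1 else 0)" by (intro sum.cong) (auto simp: e_def)
  then have e: "e \<in> exps n 0 1" using False assms by (auto simp: exps_def e_def)
  have "inverse (x l) = lmono n e x" for x
    using False assms by (simp add: lmono_def e_def if_distrib[of "\<lambda>k. _ powi k"] prod.delta power_int_minus cong: if_cong)
  then show ?thesis by (intro laurent_cong[OF laurent_lmono[OF e]])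
qed

lemma sum_decrease_at:
  fixes u v :: "nat \<Rightarrow> nat"
  assumes "i \<in> {1..n}" "v i = Suc (u i)" "\<And>j. j \<noteq> i \<Longrightarrow> u j = v j"
  shows "sum v {1..n} = Suc (sum u {1..n})"
proof -
  have "sum v {1..n} = v i + sum v ({1..n} - {i})" using assms by (intro sum.remove) auto
  also have "sum v ({1..n} - {i}) = sum u ({1..n} - {i})" using assms by (intro sum.cong) auto
  also have "v i + \<dots> = Suc (u i + sum u ({1..n} - {i}))" using assms by simp
  also have "u i + sum u ({1..n} - {i}) = sum u {1..n}" using assms by (intro sum.remove[symmetric]) auto
  finally show ?thesis .
qed

text \<open>
  If the numerator already has degree at most \<open>a\<close>, then the constant coordinate \<open>x 0\<close>
  is split off.
\<close>

lemma lmono_extract_coord: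
  assumes e: "e \<in> exps n (Suc a) b"
  shows "\<exists>l\<le>n. \<exists>e'\<in>exps n a b. \<forall>x\<in>torus n. lmono n e x = x l * lmono n e' x"
proof (cases "\<exists>i\<in>{1..n}. e i > 0")
  case False
  then have "(\<Sum>i=1..n. nat (e i)) = 0" by (auto intro!: sum.neutral)
  then have "e \<in> exps n a b" using e by (auto simp: exps_def)
  then show ?thesis by (intro exI[of _ 0] conjI bexI[of _ e]) (auto simp: torus_def)
next
  case True
  then obtain i where i: "i \<in> {1..n}" "e i > 0" by auto
  define e' where "e' = e(i := e i - 1)"
  have "(\<Sum>j=1..n. nat (e j)) = Suc (\<Sum>j=1..n. nat (e' j))"
    using i by (intro sum_decrease_at[of i]) (auto simp: e'_def nat_diff_distrib)
  moreover have "(\<Sum>j=1..n. nat (- e' j)) = (\<Sum>j=1..n. nat (- e j))"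
    using i by (intro sum.cong) (auto simp: e'_def)
  ultimately have e': "e' \<in> exps n a b" using e i by (auto simp: exps_def e'_def)
  have "lmono n e x = x i * lmono n e' x" if "x \<in> torus n" for x
  proof -
    have "lmono n e x = x i powi e i * (\<Prod>j\<in>{1..n}-{i}. x j powi e j)"
      unfolding lmono_def using i by (intro prod.remove) auto
    also have "(\<Prod>j\<in>{1..n}-{i}. x j powi e j) = (\<Prod>j\<in>{1..n}-{i}. x j powi e' j)"
      by (intro prod.cong) (auto simp: e'_def)
    also have "x i powi e i = x i * x i powi e' i"
      using that i power_int_add_1'[of "x i" "e i - 1"] by (auto simp: e'_def torus_def)
    also have "\<dots> * (\<Prod>j\<in>{1..n}-{i}. x j powi e' j) = x i * lmono n e' x"
      unfolding lmono_def using i by (subst prod.remove[of "{1..n}" i]) (auto simp: mult.assoc)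
    finally show ?thesis .
  qed
  with e' i show ?thesis by (intro exI[of _ i] conjI bexI[of _ e']) auto
qed

lemma lmono_extract_inverse_coord:
  assumes e: "e \<in> exps n a (Suc b)"
  shows "\<exists>l\<le>n. \<exists>e'\<in>exps n a b. \<forall>x\<in>torus n. lmono n e x = inverse (x l) * lmono n e' x"
proof -
  have "(\<lambda>i. - e i) \<in> exps n (Suc b) a" using e by (auto simp: exps_def)
  from lmono_extract_coord[OF this] obtain l e' where l: "l \<le> n" and e': "e' \<in> exps n b a"
    and eq: "\<And>x. x \<in> torus n \<Longrightarrow> lmono n (\<lambda>i. - e i) x = x l * lmono n e' x" by auto
  have inv: "lmono n (\<lambda>i. - f i) x = lmono n f (\<lambda>i. inverse (x i))" for f x
    by (simp add: lmono_def power_int_minus power_int_inverse)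
  have "lmono n e x = inverse (x l) * lmono n (\<lambda>i. - e' i) x" if "x \<in> torus n" for x
  proof -
    have "(\<lambda>i. inverse (x i)) \<in> torus n" using that by (auto simp: torus_def)
    from eq[OF this] show ?thesis by (simp add: inv)
  qed
  moreover have "(\<lambda>i. - e' i) \<in> exps n a b" using e' by (auto simp: exps_def)
  ultimately show ?thesis using l by blast
qed

section \<open>Lowering the bidegree modulo the equations\<close>

text \<open>
  Coordinates and Fourier coefficients in a single indexing: for prime \<open>p\<close> and \<open>\<omega> \<noteq> 1\<close> with
  \<open>\<omega> ^ p = 1\<close>, any \<open>p\<close> of these \<open>2 * p\<close> linear forms are independent.
\<close>

definition form :: "nat \<Rightarrow> complex \<Rightarrow> nat \<Rightarrow> nat \<Rightarrow> complex" where
  "form p \<omega> i k = (if i < p then (if k = i then 1 else 0) else \<omega> ^ ((i - p) * k))"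

text \<open>
  If \<open>p\<close> of the forms vanish at \<open>x\<close>, then \<open>x\<close> has as many prescribed zeros as its
  Fourier transform has possibly nonzero entries; Chebotarev's theorem gives \<open>x = 0\<close>, and
  duality turns the trivial kernel into spanning.
\<close>

lemma prime_root_forms_span:
  assumes p: "prime p" and \<omega>: "\<omega> ^ p = 1" "\<omega> \<noteq> 1"
    and B: "B \<subseteq> {..<2*p}" "p \<le> card B" and l: "l < p"
  shows "\<exists>c. \<forall>x. x l = (\<Sum>i\<in>B. c i * (\<Sum>k<p. form p \<omega> i k * x k))"
proof -
  have finB: "finite B" using B finite_subset by blast
  obtain B' where B': "B' \<subseteq> B" "card B' = p" "finite B'"
    using obtain_subset_with_card_n[OF B(2)] finB by (metis finite_subset)
  have triv: "\<forall>k\<in>{..<p}. x k = 0" if x: "\<forall>i\<in>B'. (\<Sum>k<p. form p \<omega> i k * x k) = 0" for x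
  proof -
    define S where "S = {..<p} - B'"
    define T where "T = {t. p + t \<in> B'}"
    have off: "x k = 0" if "k \<in> B'" "k < p" for k
      using x[rule_format, OF that(1)] that by (simp add: form_def if_distrib[of "\<lambda>z. z * _"] cong: if_cong)
    have B'eq: "B' = (B' \<inter> {..<p}) \<union> (\<lambda>t. p + t) ` T"
    proof (intro equalityI subsetI)
      fix i assume i: "i \<in> B'"
      show "i \<in> (B' \<inter> {..<p}) \<union> (\<lambda>t. p + t) ` T"
      proof (cases "i < p")
        case False
        then have "i = p + (i - p)" by simp
        then show ?thesis using i unfolding T_def by (metis UnI2 imageI mem_Collect_eq)
      qed (use i in auto)
    qed (auto simp: T_def)
    have T: "T \<subseteq> {..<p}" using B' B by (auto simp: T_def)
    then have "finite T" using finite_subset by blast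
    then have "card B' = card (B' \<inter> {..<p}) + card T"
      using B' by (subst B'eq, subst card_Un_disjoint) (auto simp: card_image)
    moreover have "card S = p - card (B' \<inter> {..<p})"
      unfolding S_def by (metis Int_commute card_Diff_subset_Int card_lessThan finite_Int finite_lessThan)
    ultimately have "card S \<le> card T" using B' by simp
    moreover have "(\<Sum>k\<in>S. x k * \<omega> ^ (t * k)) = 0" if "t \<in> T" for t
    proof -
      have "(\<Sum>k\<in>S. x k * \<omega> ^ (t * k)) = (\<Sum>k<p. form p \<omega> (p + t) k * x k)"
        by (rule sum.mono_neutral_cong_left) (use off in \<open>auto simp: S_def form_def\<close>)
      also have "\<dots> = 0" using x that by (auto simp: T_def)
      finally show ?thesis .
    qed
    ultimately have "\<forall>k\<in>S. x k = 0"
      using T by (intro chebotarev_vanishing[OF p \<omega>, of S T]) (auto simp: S_def)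
    then show ?thesis using off by (auto simp: S_def)
  qed
  obtain c where c: "\<forall>k\<in>{..<p}. (if k = l then 1 else 0) = (\<Sum>i\<in>B'. c i * form p \<omega> i k)"
    using forms_span[where l = "\<lambda>k. if k = l then 1 else 0", OF B'(3) finite_lessThan _ triv] B'(2)
    unfolding card_lessThan by blast
  have "x l = (\<Sum>i\<in>B. (if i \<in> B' then c i else 0) * (\<Sum>k<p. form p \<omega> i k * x k))" for x
  proof -
    have "x l = (\<Sum>k<p. (if k = l then 1 else 0) * x k)"
      using l by (simp add: if_distrib[of "\<lambda>z. z * _"] cong: if_cong)
    also have "\<dots> = (\<Sum>k<p. (\<Sum>i\<in>B'. c i * form p \<omega> i k) * x k)"
      using c by (intro sum.cong) auto
    also have "\<dots> = (\<Sum>i\<in>B'. c i * (\<Sum>k<p. form p \<omega> i k * x k))"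
      unfolding sum_distrib_right sum_distrib_left by (subst sum.swap) (simp add: mult.assoc)
    also have "\<dots> = (\<Sum>i\<in>B. (if i \<in> B' then c i else 0) * (\<Sum>k<p. form p \<omega> i k * x k))"
      using B' finB by (intro sum.mono_neutral_cong_left) auto
    finally show ?thesis .
  qed
  then show ?thesis
    by (intro exI[of _ "\<lambda>i. if i \<in> B' then c i else 0"] allI)
qed

locale prime_fourier =
  fixes p :: nat and \<omega> :: complex
  assumes p: "prime p" and \<omega>: "\<omega> ^ p = 1" "\<omega> \<noteq> 1"
begin

definition n :: nat where "n = p - 1"

definition aform :: "nat \<Rightarrow> (nat \<Rightarrow> complex) \<Rightarrow> complex" where
  "aform i x = (\<Sum>k<p. form p \<omega> i k * x k)"

definition bform :: "nat \<Rightarrow> (nat \<Rightarrow> complex) \<Rightarrow> complex" where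
  "bform i x = (\<Sum>k<p. form p (inverse \<omega>) i k * inverse (x k))"

text \<open>
  The value of \<open>aform i * bform i\<close> at the points that come from Hadamard matrices.
\<close>

definition \<kappa> :: "nat \<Rightarrow> complex" where
  "\<kappa> i = (if i < p then 1 else of_nat p)"

definition cfun :: "nat \<Rightarrow> (nat \<Rightarrow> complex) \<Rightarrow> complex" where
  "cfun i x = aform i x * bform i x - \<kappa> i"

lemma p_pos: "p > 0" using p prime_gt_0_nat by blast

lemma le_n_iff: "k \<le> n \<longleftrightarrow> k < p" using p_pos by (auto simp: n_def)

lemma aform_span:
  assumes "B \<subseteq> {..<2*p}" "p \<le> card B" "l < p"
  shows "\<exists>c. \<forall>x. x l = (\<Sum>i\<in>B. c i * aform i x)"
  using prime_root_forms_span[OF p \<omega> assms] unfolding aform_def .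

lemma bform_span:
  assumes "B \<subseteq> {..<2*p}" "p \<le> card B" "l < p"
  shows "\<exists>c. \<forall>x. inverse (x l) = (\<Sum>i\<in>B. c i * bform i x)"
proof -
  have "inverse \<omega> ^ p = 1" "inverse \<omega> \<noteq> 1" using \<omega> by (auto simp: power_inverse)
  from prime_root_forms_span[OF p this assms] obtain c where
    "\<And>x. x l = (\<Sum>i\<in>B. c i * (\<Sum>k<p. form p (inverse \<omega>) i k * x k))" by blast
  from this[of "\<lambda>i. inverse (_ i)"] show ?thesis unfolding bform_def by auto
qed

lemma aform_laurent: "aform i \<in> laurent n 1 0"
  unfolding aform_def by (intro laurent_sum laurent_scale laurent_coord) (auto simp: le_n_iff)

lemma bform_laurent: "bform i \<in> laurent n 0 1"
  unfolding bform_def by (intro laurent_sum laurent_scale laurent_inverse_coord) (auto simp: le_n_iff)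

lemma cfun_laurent: "cfun i \<in> laurent n 1 1"
  using laurent_mult[OF aform_laurent bform_laurent, of i i] unfolding cfun_def
  by (intro laurent_diff laurent_const) auto

lemma bform_prod_laurent: "finite B \<Longrightarrow> (\<lambda>x. \<Prod>i\<in>B. bform i x) \<in> laurent n 0 (card B)"
proof (induction B rule: finite_induct)
  case (insert i B)
  from laurent_mult[OF bform_laurent[of i] insert.IH] show ?case using insert.hyps by simp
qed (auto intro: laurent_const)

text \<open>
  What one reduction step produces from bidegree \<open>(d + 1, d + 1)\<close>.  Recording the bidegree of the
  cofactors of the equations makes the step usable in an induction on the order of vanishing.
\<close>

definition reducible :: "nat \<Rightarrow> ((nat \<Rightarrow> complex) \<Rightarrow> complex) set" where
  "reducible d = {f. \<exists>f0\<in>laurent n d d. \<exists>g. (\<forall>i<2*p. g i \<in> laurent n d d) \<and>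
     (\<forall>x\<in>torus n. f x = f0 x + (\<Sum>i<2*p. cfun i x * g i x))}"

lemma reducible_cong:
  "f \<in> reducible d \<Longrightarrow> (\<And>x. x \<in> torus n \<Longrightarrow> g x = f x) \<Longrightarrow> g \<in> reducible d"
  by (auto simp: reducible_def)

lemma laurent_reducible: "f \<in> laurent n d d \<Longrightarrow> f \<in> reducible d"
  unfolding reducible_def by (auto intro!: bexI[of _ f] exI[of _ "\<lambda>_ _. 0"])

lemma reducible_add:
  assumes "f \<in> reducible d" "h \<in> reducible d"
  shows "(\<lambda>x. f x + h x) \<in> reducible d"
proof -
  from assms obtain f0 f1 h0 h1 where *: "f0 \<in> laurent n d d" "h0 \<in> laurent n d d"
    "\<forall>i<2*p. f1 i \<in> laurent n d d" "\<forall>i<2*p. h1 i \<in> laurent n d d"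
    "\<forall>x\<in>torus n. f x = f0 x + (\<Sum>i<2*p. cfun i x * f1 i x)"
    "\<forall>x\<in>torus n. h x = h0 x + (\<Sum>i<2*p. cfun i x * h1 i x)" unfolding reducible_def by blast
  show ?thesis unfolding reducible_def
    by (intro CollectI bexI[of _ "\<lambda>x. f0 x + h0 x"] exI[of _ "\<lambda>i x. f1 i x + h1 i x"])
      (use * in \<open>auto simp: distrib_left sum.distrib\<close>)
qed

lemma reducible_scale:
  assumes "f \<in> reducible d"
  shows "(\<lambda>x. k * f x) \<in> reducible d"
proof -
  from assms obtain f0 f1 where *: "f0 \<in> laurent n d d"
    "\<forall>i<2*p. f1 i \<in> laurent n d d"
    "\<forall>x\<in>torus n. f x = f0 x + (\<Sum>i<2*p. cfun i x * f1 i x)" unfolding reducible_def by blast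
  show ?thesis unfolding reducible_def
    by (intro CollectI bexI[of _ "\<lambda>x. k * f0 x"] exI[of _ "\<lambda>i x. k * f1 i x"])
      (use * in \<open>auto simp: distrib_left sum_distrib_left mult_ac\<close>)
qed

lemma reducible_sum:
  assumes "\<And>i. i \<in> I \<Longrightarrow> f i \<in> reducible d"
  shows "(\<lambda>x. \<Sum>i\<in>I. f i x) \<in> reducible d"
  using assms
  by (induction I rule: infinite_finite_induct)
    (auto intro: reducible_add laurent_reducible laurent_zero)

lemma aform_bform_reducible:
  assumes i: "i < 2 * p" and h: "h \<in> laurent n d d"
  shows "(\<lambda>x. aform i x * bform i x * h x) \<in> reducible d"
  unfolding reducible_def
proof (intro CollectI bexI[of _ "\<lambda>x. \<kappa> i * h x"] exI[of _ "\<lambda>j x. if j = i then h x else 0"] conjI ballI allI impI)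
  fix x
  show "aform i x * bform i x * h x = \<kappa> i * h x + (\<Sum>j<2*p. cfun j x * (if j = i then h x else 0))"
  proof -
    have "(\<Sum>j<2*p. cfun j x * (if j = i then h x else 0)) = (\<Sum>j<2*p. if j = i then cfun i x * h x else 0)"
      by (intro sum.cong) auto
    also have "\<dots> = cfun i x * h x" using i by simp
    finally show ?thesis by (simp add: cfun_def algebra_simps)
  qed
next
  fix j show "(\<lambda>x. if j = i then h x else 0) \<in> laurent n d d" using h by (cases "j = i") auto
qed (use h in auto)

text \<open>
  As long as \<open>B\<close> has fewer than \<open>p\<close> elements, its complement still has at least
  \<open>p\<close>, so a factor \<open>inverse (x l)\<close> of \<open>f\<close> can be expanded in forms \<open>bform i\<close>
  with \<open>i \<notin> B\<close>, which enlarges \<open>B\<close>.  Once \<open>B\<close> has \<open>p\<close> elements, a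
  factor \<open>x l\<close> is expanded in the forms \<open>aform i\<close> with \<open>i \<in> B\<close>, and the degree drops
  because \<open>aform i * bform i = \<kappa> i + cfun i\<close>.
\<close>

lemma bform_prod_reducible:
  assumes "B \<subseteq> {..<2*p}" "card B \<le> p" "p \<le> Suc d" "f \<in> laurent n (Suc d) (Suc d - card B)"
  shows "(\<lambda>x. (\<Prod>i\<in>B. bform i x) * f x) \<in> reducible d"
  using assms
proof (induction "p - card B" arbitrary: B f)
  case 0
  then have card: "card B = p" and fin: "finite B" using finite_subset by auto
  from 0(5) show ?case
  proof (induction rule: laurent_induct)
    case (cong f g)
    from cong(1) show ?case by (rule reducible_cong) (simp add: cong)
  next
    case (add f g)
    from reducible_add[OF this] show ?case by (simp add: distrib_left)
  next
    case (scale c f)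
    from reducible_scale[OF this, of c] show ?case by (simp add: mult_ac)
  next
    case zero
    show ?case using laurent_reducible[OF laurent_zero] by simp
  next
    case (lmono e)
    from lmono_extract_coord[OF this] obtain l e' where l: "l \<le> n" and e': "e' \<in> exps n d (Suc d - p)"
      and eq: "\<And>x. x \<in> torus n \<Longrightarrow> lmono n e x = x l * lmono n e' x" by (auto simp: card)
    have "l < p" using l by (simp add: le_n_iff)
    from aform_span[OF 0(2) _ this] card obtain c where c: "\<And>x. x l = (\<Sum>i\<in>B. c i * aform i x)" by auto
    have red: "(\<lambda>x. aform i x * bform i x * ((\<Prod>j\<in>B-{i}. bform j x) * lmono n e' x)) \<in> reducible d"
      if i: "i \<in> B" for i
    proof (rule aform_bform_reducible)
      show "i < 2 * p" using i 0 by auto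
      have "card (B - {i}) + (Suc d - p) = d" using i card fin 0(4) p_pos by simp
      then show "(\<lambda>x. (\<Prod>j\<in>B-{i}. bform j x) * lmono n e' x) \<in> laurent n d d"
        using laurent_mult[OF bform_prod_laurent[of "B - {i}"] laurent_lmono[OF e']] fin by simp
    qed
    have "(\<lambda>x. \<Sum>i\<in>B. c i * (aform i x * bform i x * ((\<Prod>j\<in>B-{i}. bform j x) * lmono n e' x))) \<in> reducible d"
      by (intro reducible_sum reducible_scale red)
    then show ?case
    proof (rule reducible_cong)
      fix x assume x: "x \<in> torus n"
      have "(\<Prod>i\<in>B. bform i x) * lmono n e x
          = (\<Sum>i\<in>B. c i * aform i x * (\<Prod>j\<in>B. bform j x) * lmono n e' x)"
        unfolding eq[OF x] c[of x] by (simp add: sum_distrib_left sum_distrib_right mult_ac)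
      also have "\<dots> = (\<Sum>i\<in>B. c i * (aform i x * bform i x * ((\<Prod>j\<in>B-{i}. bform j x) * lmono n e' x)))"
      proof (intro sum.cong refl)
        fix i assume "i \<in> B"
        from prod.remove[OF fin this, of "\<lambda>j. bform j x"]
        show "c i * aform i x * (\<Prod>j\<in>B. bform j x) * lmono n e' x
            = c i * (aform i x * bform i x * ((\<Prod>j\<in>B-{i}. bform j x) * lmono n e' x))"
          by (simp only: mult_ac)
      qed
      finally show "(\<Prod>i\<in>B. bform i x) * lmono n e x = \<dots>" .
    qed
  qed
next
  case (Suc r)
  have fin: "finite B" using Suc.prems(1) finite_subset by auto
  have card: "card B < p" using Suc.hyps(2) by linarith
  from Suc.prems(4) show ?case
  proof (induction rule: laurent_induct)
    case (cong f g)
    from cong(1) show ?case by (rule reducible_cong) (simp add: cong)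
  next
    case (add f g)
    from reducible_add[OF this] show ?case by (simp add: distrib_left)
  next
    case (scale c f)
    from reducible_scale[OF this, of c] show ?case by (simp add: mult_ac)
  next
    case zero
    show ?case using laurent_reducible[OF laurent_zero] by simp
  next
    case (lmono e)
    have "Suc d - card B = Suc (Suc d - Suc (card B))" using card Suc.prems by simp
    with lmono have "e \<in> exps n (Suc d) (Suc (Suc d - Suc (card B)))" by simp
    from lmono_extract_inverse_coord[OF this] obtain l e' where l: "l \<le> n"
      and e': "e' \<in> exps n (Suc d) (Suc d - Suc (card B))"
      and eq: "\<And>x. x \<in> torus n \<Longrightarrow> lmono n e x = inverse (x l) * lmono n e' x" by blast
    have "l < p" using l by (simp add: le_n_iff)
    moreover have "p \<le> card ({..<2*p} - B)"
      using Suc.prems(1) card fin by (subst card_Diff_subset) auto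
    ultimately obtain c where c: "\<And>x. inverse (x l) = (\<Sum>i\<in>{..<2*p}-B. c i * bform i x)"
      using bform_span[of "{..<2*p} - B" l] by auto
    have red: "(\<lambda>x. (\<Prod>j\<in>insert i B. bform j x) * lmono n e' x) \<in> reducible d"
      if i: "i \<in> {..<2*p} - B" for i
    proof (rule Suc.hyps(1))
      have "card (insert i B) = Suc (card B)" using i fin by simp
      then show "r = p - card (insert i B)" "card (insert i B) \<le> p"
        "lmono n e' \<in> laurent n (Suc d) (Suc d - card (insert i B))"
        using Suc.hyps(2) card laurent_lmono[OF e'] by auto
    qed (use i Suc.prems in auto)
    have "(\<lambda>x. \<Sum>i\<in>{..<2*p}-B. c i * ((\<Prod>j\<in>insert i B. bform j x) * lmono n e' x)) \<in> reducible d"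
      by (intro reducible_sum reducible_scale red)
    then show ?case
    proof (rule reducible_cong)
      fix x assume x: "x \<in> torus n"
      have "(\<Prod>i\<in>B. bform i x) * lmono n e x
          = (\<Sum>i\<in>{..<2*p}-B. c i * (bform i x * (\<Prod>j\<in>B. bform j x) * lmono n e' x))"
        unfolding eq[OF x] c[of x] by (simp add: sum_distrib_left sum_distrib_right mult_ac)
      also have "\<dots> = (\<Sum>i\<in>{..<2*p}-B. c i * ((\<Prod>j\<in>insert i B. bform j x) * lmono n e' x))"
        using fin by (intro sum.cong refl) auto
      finally show "(\<Prod>i\<in>B. bform i x) * lmono n e x = \<dots>" .
    qed
  qed
qed

lemma laurent_Suc_reducible:
  assumes "p \<le> Suc d" "f \<in> laurent n (Suc d) (Suc d)"
  shows "f \<in> reducible d"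
proof -
  have "(\<lambda>x. (\<Prod>i\<in>{}. bform i x) * f x) \<in> reducible d"
    by (rule bform_prod_reducible) (use assms in auto)
  then show ?thesis by simp
qed

end

section \<open>Order of vanishing at points of the torus\<close>

text \<open>
  Vanishing to order \<open>k\<close> at the points of \<open>A\<close>, tested along complex lines; the direction
  \<open>v\<close> keeps the normalisation \<open>x 0 = 1\<close>.
\<close>

definition vanishing :: "(nat \<Rightarrow> complex) set \<Rightarrow> nat \<Rightarrow> ((nat \<Rightarrow> complex) \<Rightarrow> complex) set" where
  "vanishing A k = {f. \<forall>a\<in>A. \<forall>v. v 0 = 0 \<longrightarrow>
     (\<lambda>t::complex. f (\<lambda>i. a i + t * v i)) \<in> O[at 0](\<lambda>t. t ^ k)}"

lemma eventually_line_torus: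
  assumes "a \<in> torus n" "v 0 = 0"
  shows "\<forall>\<^sub>F t::complex in at 0. (\<lambda>i. a i + t * v i) \<in> torus n"
proof -
  have "\<forall>\<^sub>F t in at 0. a i + t * v i \<noteq> 0" if "i \<in> {1..n}" for i
  proof (rule tendsto_imp_eventually_ne)
    show "((\<lambda>t. a i + t * v i) \<longlongrightarrow> a i + 0 * v i) (at 0)" by (intro tendsto_intros)
    show "a i + 0 * v i \<noteq> 0" using assms that by (simp add: torus_def)
  qed
  then have "\<forall>\<^sub>F t in at 0. \<forall>i\<in>{1..n}. a i + t * v i \<noteq> 0"
    by (intro eventually_ball_finite) auto
  then show ?thesis by eventually_elim (use assms in \<open>auto simp: torus_def\<close>)
qed

lemma laurent_line_tendsto:
  assumes f: "f \<in> laurent n b c" and a: "a \<in> torus n" and v: "v 0 = 0"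
  shows "((\<lambda>t::complex. f (\<lambda>i. a i + t * v i)) \<longlongrightarrow> f a) (at 0)"
  using f
proof (induction rule: laurent_induct)
  case (cong f g)
  have "\<forall>\<^sub>F t::complex in at 0. f (\<lambda>i. a i + t * v i) = g (\<lambda>i. a i + t * v i)"
    using eventually_line_torus[of a n v, OF a v] by eventually_elim (simp add: cong)
  from tendsto_cong[OF this] cong(1) cong(2)[OF a] show ?case by simp
next
  case (lmono e)
  show ?case unfolding lmono_def
  proof (intro tendsto_prod tendsto_power_int)
    fix i assume i: "i \<in> {1..n}"
    have "((\<lambda>t. a i + t * v i) \<longlongrightarrow> a i + 0 * v i) (at 0)" by (intro tendsto_intros)
    then show "((\<lambda>t. a i + t * v i) \<longlongrightarrow> a i) (at 0)" by simp
    show "a i \<noteq> 0" using a i by (auto simp: torus_def)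
  qed
qed (auto intro: tendsto_intros)

lemma vanishing_cong:
  assumes "f \<in> vanishing A k" "A \<subseteq> torus n" "\<And>x. x \<in> torus n \<Longrightarrow> g x = f x"
  shows "g \<in> vanishing A k"
  unfolding vanishing_def
proof (intro CollectI ballI allI impI)
  fix a v assume a: "a \<in> A" and v: "v (0::nat) = (0::complex)"
  have "\<forall>\<^sub>F t::complex in at 0. (\<lambda>i. a i + t * v i) \<in> torus n"
    using assms(2) a v by (intro eventually_line_torus) auto
  then have "\<forall>\<^sub>F t::complex in at 0. g (\<lambda>i. a i + t * v i) = f (\<lambda>i. a i + t * v i)"
    by eventually_elim (simp add: assms(3))
  from landau_o.big.in_cong[OF this] assms(1) a v
  show "(\<lambda>t. g (\<lambda>i. a i + t * v i)) \<in> O[at 0](\<lambda>t. t ^ k)" by (auto simp: vanishing_def)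
qed

lemma vanishing_zero: "(\<lambda>x. 0) \<in> vanishing A k"
  by (simp add: vanishing_def)

lemma vanishing_add:
  "f \<in> vanishing A k \<Longrightarrow> g \<in> vanishing A k \<Longrightarrow> (\<lambda>x. f x + g x) \<in> vanishing A k"
  unfolding vanishing_def by (auto intro: sum_in_bigo)

lemma vanishing_scale: "f \<in> vanishing A k \<Longrightarrow> (\<lambda>x. c * f x) \<in> vanishing A k"
  unfolding vanishing_def by (cases "c = 0") auto

lemma vanishing_sum:
  "(\<And>i. i \<in> I \<Longrightarrow> f i \<in> vanishing A k) \<Longrightarrow> (\<lambda>x. \<Sum>i\<in>I. f i x) \<in> vanishing A k"
  by (induction I rule: infinite_finite_induct) (auto intro: vanishing_add vanishing_zero)

lemma vanishing_mult:
  "f \<in> vanishing A j \<Longrightarrow> g \<in> vanishing A k \<Longrightarrow> (\<lambda>x. f x * g x) \<in> vanishing A (j + k)"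
  unfolding vanishing_def by (auto simp: power_add intro: landau_o.big.mult)

lemma laurent_vanishing_0:
  assumes "f \<in> laurent n b c" "A \<subseteq> torus n"
  shows "f \<in> vanishing A 0"
  unfolding vanishing_def
proof (intro CollectI ballI allI impI)
  fix a v assume a: "a \<in> A" and v: "v (0::nat) = (0::complex)"
  have "((\<lambda>t::complex. f (\<lambda>i. a i + t * v i)) \<longlongrightarrow> f a) (at 0)"
    using assms a v by (intro laurent_line_tendsto) auto
  then show "(\<lambda>t. f (\<lambda>i. a i + t * v i)) \<in> O[at 0](\<lambda>t. t ^ 0)"
    by (intro bigoI_tendsto[where c = "f a"]) auto
qed

context prime_fourier
begin

text \<open>
  A zero of a differentiable function has order at least one.
\<close>

lemma cfun_vanishing:
  assumes A: "A \<subseteq> torus n" and zero: "\<And>a. a \<in> A \<Longrightarrow> cfun i a = 0"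
  shows "cfun i \<in> vanishing A 1"
  unfolding vanishing_def
proof (intro CollectI ballI allI impI)
  fix a v assume a: "a \<in> A" and v: "v (0::nat) = (0::complex)"
  have a0: "a k \<noteq> 0" if "k < p" for k
    using a A that by (cases "k = 0") (auto simp: torus_def le_n_iff)
  have dA: "((\<lambda>t. aform i (\<lambda>i. a i + t * v i)) has_field_derivative
      (\<Sum>k<p. form p \<omega> i k * v k)) (at 0)"
    unfolding aform_def by (auto intro!: derivative_eq_intros sum.cong)
  have dB: "((\<lambda>t. bform i (\<lambda>i. a i + t * v i)) has_field_derivative
      (\<Sum>k<p. form p (inverse \<omega>) i k * - (inverse (a k) * v k * inverse (a k)))) (at 0)"
    unfolding bform_def by (auto intro!: derivative_eq_intros sum.cong simp: a0 mult_ac)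
  obtain D where "((\<lambda>t. cfun i (\<lambda>i. a i + t * v i)) has_field_derivative D) (at 0)"
    using DERIV_diff[OF DERIV_mult[OF dA dB] DERIV_const[of "\<kappa> i"]] unfolding cfun_def by blast
  then have "((\<lambda>t. cfun i (\<lambda>i. a i + t * v i) / t) \<longlongrightarrow> D) (at 0)"
    using zero[OF a] by (simp add: DERIV_def)
  then show "(\<lambda>t. cfun i (\<lambda>i. a i + t * v i)) \<in> O[at 0](\<lambda>t. t ^ 1)"
    by (intro bigoI_tendsto[where c = D]) (auto simp: eventually_at_filter)
qed

text \<open>
  Each reduction step either lowers the bidegree or gains a factor \<open>cfun i\<close>, that is, one order
  of vanishing, at the price of one in the bidegree.
\<close>

lemma laurent_reduce_mod_vanishing:
  assumes A: "A \<subseteq> torus n" and zero: "\<And>a i. a \<in> A \<Longrightarrow> i < 2 * p \<Longrightarrow> cfun i a = 0"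
    and f: "f \<in> laurent n q q"
  shows "\<exists>g\<in>laurent n (p + k) (p + k). (\<lambda>x. f x - g x) \<in> vanishing A k"
  using f
proof (induction k arbitrary: f q)
  case 0
  show ?case
    by (rule bexI[of _ "\<lambda>x. 0"]) (use laurent_vanishing_0[OF 0 A] in auto)
next
  case (Suc k)
  note IHk = Suc.IH
  from Suc.prems show ?case
  proof (induction q arbitrary: f)
    case 0
    show ?case
      by (rule bexI[of _ f])
        (use 0 in \<open>auto intro: vanishing_zero laurent_mono_le\<close>)
  next
    case (Suc q)
    show ?case
    proof (cases "Suc q \<le> p + Suc k")
      case True
      show ?thesis
        by (rule bexI[of _ f])
          (use Suc.prems True in \<open>auto intro: vanishing_zero laurent_mono_le\<close>)
    next
      case False
      then have "f \<in> reducible q" using Suc.prems by (intro laurent_Suc_reducible) auto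
      then obtain f0 f1 where f0: "f0 \<in> laurent n q q" and f1: "\<And>i. i < 2*p \<Longrightarrow> f1 i \<in> laurent n q q"
        and feq: "\<And>x. x \<in> torus n \<Longrightarrow> f x = f0 x + (\<Sum>i<2*p. cfun i x * f1 i x)"
        unfolding reducible_def by blast
      from Suc.IH[OF f0] obtain g0 where g0: "g0 \<in> laurent n (p + Suc k) (p + Suc k)"
        "(\<lambda>x. f0 x - g0 x) \<in> vanishing A (Suc k)" by blast
      have "\<forall>i. \<exists>g. i < 2*p \<longrightarrow> g \<in> laurent n (p + k) (p + k) \<and> (\<lambda>x. f1 i x - g x) \<in> vanishing A k"
        using IHk[OF f1] by blast
      then obtain g1 where g1: "\<And>i. i < 2*p \<Longrightarrow> g1 i \<in> laurent n (p + k) (p + k)"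
        "\<And>i. i < 2*p \<Longrightarrow> (\<lambda>x. f1 i x - g1 i x) \<in> vanishing A k" by metis
      define g where "g x = g0 x + (\<Sum>i<2*p. cfun i x * g1 i x)" for x
      have "(\<lambda>x. cfun i x * g1 i x) \<in> laurent n (p + Suc k) (p + Suc k)" if "i < 2*p" for i
        using laurent_mult[OF cfun_laurent g1(1)[OF that]] by simp
      then have g: "g \<in> laurent n (p + Suc k) (p + Suc k)"
        unfolding g_def by (intro laurent_add g0 laurent_sum) auto
      have "(\<lambda>x. cfun i x * (f1 i x - g1 i x)) \<in> vanishing A (Suc k)" if "i < 2*p" for i
        using vanishing_mult[OF cfun_vanishing[OF A] g1(2)[OF that], of i] zero that by simp
      then have "(\<lambda>x. (f0 x - g0 x) + (\<Sum>i<2*p. cfun i x * (f1 i x - g1 i x))) \<in> vanishing A (Suc k)"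
        by (intro vanishing_add g0 vanishing_sum) auto
      then have "(\<lambda>x. f x - g x) \<in> vanishing A (Suc k)"
        by (rule vanishing_cong[OF _ A])
          (simp add: feq g_def right_diff_distrib sum_subtractf)
      with g show ?thesis by blast
    qed
  qed
qed

text \<open>
  After reduction the functions live in a space spanned by fewer monomials than there are functions.
\<close>

lemma dependent_mod_vanishing:
  assumes A: "A \<subseteq> torus n" and zero: "\<And>a i. a \<in> A \<Longrightarrow> i < 2 * p \<Longrightarrow> cfun i a = 0"
    and I: "finite I" and G: "\<And>j. j \<in> I \<Longrightarrow> \<exists>q. G j \<in> laurent n q q"
    and card: "card (exps n (p + k) (p + k)) < card I"
  shows "\<exists>c. (\<exists>j\<in>I. c j \<noteq> 0) \<and> (\<lambda>x. \<Sum>j\<in>I. c j * G j x) \<in> vanishing A k"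
proof -
  have "\<forall>j. \<exists>g. j \<in> I \<longrightarrow> g \<in> laurent n (p + k) (p + k) \<and> (\<lambda>x. G j x - g x) \<in> vanishing A k"
    using laurent_reduce_mod_vanishing[OF A zero] G by metis
  then obtain g where g: "\<And>j. j \<in> I \<Longrightarrow> g j \<in> laurent n (p + k) (p + k)"
    "\<And>j. j \<in> I \<Longrightarrow> (\<lambda>x. G j x - g j x) \<in> vanishing A k" by metis
  have "\<forall>j. \<exists>d. j \<in> I \<longrightarrow> (\<forall>x\<in>torus n. g j x = (\<Sum>e\<in>exps n (p+k) (p+k). d e * lmono n e x))"
    using g(1) unfolding laurent_def by blast
  then obtain d where d: "\<And>j x. j \<in> I \<Longrightarrow> x \<in> torus n \<Longrightarrow>
      g j x = (\<Sum>e\<in>exps n (p+k) (p+k). d j e * lmono n e x)" by metis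
  from underdetermined_system[OF finite_exps I card, of d] obtain c where
    c: "\<exists>j\<in>I. c j \<noteq> 0" "\<And>e. e \<in> exps n (p+k) (p+k) \<Longrightarrow> (\<Sum>j\<in>I. c j * d j e) = 0" by blast
  have 0: "(\<Sum>j\<in>I. c j * g j x) = 0" if "x \<in> torus n" for x
  proof -
    have "(\<Sum>j\<in>I. c j * g j x) = (\<Sum>j\<in>I. c j * (\<Sum>e\<in>exps n (p+k) (p+k). d j e * lmono n e x))"
      using d that by (intro sum.cong) auto
    also have "\<dots> = (\<Sum>e\<in>exps n (p+k) (p+k). (\<Sum>j\<in>I. c j * d j e) * lmono n e x)"
      unfolding sum_distrib_left sum_distrib_right by (subst sum.swap) (simp add: mult.assoc)
    finally show ?thesis using c(2) by simp
  qed
  have "(\<lambda>x. \<Sum>j\<in>I. c j * (G j x - g j x)) \<in> vanishing A k"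
    by (intro vanishing_sum vanishing_scale g)
  then have "(\<lambda>x. \<Sum>j\<in>I. c j * G j x) \<in> vanishing A k"
    by (rule vanishing_cong[OF _ A]) (simp add: right_diff_distrib sum_subtractf 0)
  with c(1) show ?thesis by blast
qed

end

section \<open>Independence of jets\<close>

definition mexps :: "nat set \<Rightarrow> nat \<Rightarrow> (nat \<Rightarrow> nat) set" where
  "mexps A d = {\<alpha>. (\<forall>i. i \<notin> A \<longrightarrow> \<alpha> i = 0) \<and> sum \<alpha> A \<le> d}"

lemma finite_mexps [simp]:
  assumes "finite A"
  shows "finite (mexps A d)"
proof (rule finite_subset)
  show "mexps A d \<subseteq> {f. \<forall>x. (x \<in> A \<longrightarrow> f x \<in> {..d}) \<and> (x \<notin> A \<longrightarrow> f x = 0)}"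
  proof (intro subsetI CollectI allI conjI impI)
    fix \<alpha> i assume \<alpha>: "\<alpha> \<in> mexps A d" and i: "i \<in> A"
    have "\<alpha> i \<le> sum \<alpha> A" using i assms by (intro member_le_sum) auto
    then show "\<alpha> i \<in> {..d}" using \<alpha> by (auto simp: mexps_def)
  qed (auto simp: mexps_def)
  show "finite {f. \<forall>x. (x \<in> A \<longrightarrow> f x \<in> {..d}) \<and> (x \<notin> A \<longrightarrow> f x = 0)}"
    using assms by (intro finite_set_of_finite_funs) auto
qed

lemma card_mexps: "finite A \<Longrightarrow> card (mexps A d) = (d + card A) choose card A"
proof (induction A arbitrary: d rule: finite_induct)
  case empty
  have "mexps {} d = {\<lambda>_. 0}" by (auto simp: mexps_def)
  then show ?case by simp
next
  case (insert a A)
  have eq: "mexps (insert a A) d = (\<Union>j\<in>{..d}. (\<lambda>\<alpha>. \<alpha>(a := j)) ` mexps A (d - j))"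
  proof (intro equalityI subsetI)
    fix \<alpha> assume \<alpha>: "\<alpha> \<in> mexps (insert a A) d"
    have "sum (\<alpha>(a := 0)) A = sum \<alpha> A" using insert.hyps by (intro sum.cong) auto
    then have "\<alpha>(a := 0) \<in> mexps A (d - \<alpha> a)" "\<alpha> a \<le> d"
      using \<alpha> insert.hyps by (auto simp: mexps_def)
    moreover have "\<alpha> = (\<alpha>(a := 0))(a := \<alpha> a)" by simp
    ultimately show "\<alpha> \<in> (\<Union>j\<in>{..d}. (\<lambda>\<alpha>. \<alpha>(a := j)) ` mexps A (d - j))" by blast
  next
    fix \<beta> assume "\<beta> \<in> (\<Union>j\<in>{..d}. (\<lambda>\<alpha>. \<alpha>(a := j)) ` mexps A (d - j))"
    then obtain j \<alpha> where j: "j \<le> d" "\<alpha> \<in> mexps A (d - j)" "\<beta> = \<alpha>(a := j)" by auto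
    have "sum (\<alpha>(a := j)) A = sum \<alpha> A" using insert.hyps by (intro sum.cong) auto
    then show "\<beta> \<in> mexps (insert a A) d" using j insert.hyps by (auto simp: mexps_def)
  qed
  have "card (mexps (insert a A) d) = (\<Sum>j\<le>d. card ((\<lambda>\<alpha>. \<alpha>(a := j)) ` mexps A (d - j)))"
    unfolding eq
  proof (rule card_UN_disjoint)
    show "\<forall>i\<in>{..d}. \<forall>j\<in>{..d}. i \<noteq> j \<longrightarrow>
        (\<lambda>\<alpha>. \<alpha>(a := i)) ` mexps A (d - i) \<inter> (\<lambda>\<alpha>. \<alpha>(a := j)) ` mexps A (d - j) = {}"
      by (auto dest: fun_cong[of _ _ a])
  qed (use insert.hyps in auto)
  also have "\<dots> = (\<Sum>j\<le>d. card (mexps A (d - j)))"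
  proof (intro sum.cong refl card_image inj_onI)
    fix j \<alpha> \<beta> assume *: "\<alpha> \<in> mexps A (d - j)" "\<beta> \<in> mexps A (d - j)" "\<alpha>(a := j) = \<beta>(a := j)"
    show "\<alpha> = \<beta>"
    proof
      fix i show "\<alpha> i = \<beta> i"
        using *(1,2) insert.hyps fun_cong[OF *(3), of i] by (cases "i = a") (auto simp: mexps_def)
    qed
  qed
  also have "\<dots> = (\<Sum>j\<le>d. (card A + j) choose card A)"
    unfolding insert.IH
    by (rule sum.reindex_bij_witness[of _ "\<lambda>j. d - j" "\<lambda>j. d - j"]) (auto simp: add.commute)
  also have "\<dots> = (d + card (insert a A)) choose card (insert a A)"
    using insert.hyps choose_rising_sum(1)[of "card A" d] by (simp add: add_ac)
  finally show ?case .
qed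

lemma multivariate_polynomial_eq_0:
  fixes c :: "(nat \<Rightarrow> nat) \<Rightarrow> complex"
  assumes "finite A" "finite F" "\<And>\<alpha> i. \<alpha> \<in> F \<Longrightarrow> i \<notin> A \<Longrightarrow> \<alpha> i = 0"
    and "\<And>v. (\<Sum>\<alpha>\<in>F. c \<alpha> * (\<Prod>i\<in>A. v i ^ \<alpha> i)) = 0"
  shows "\<forall>\<alpha>\<in>F. c \<alpha> = 0"
  using assms
proof (induction A arbitrary: F c rule: finite_induct)
  case empty
  show ?case
  proof
    fix \<alpha> assume \<alpha>: "\<alpha> \<in> F"
    have "F = {\<alpha>}" using empty.prems(2) \<alpha> by (metis empty_iff ext is_singletonI' is_singleton_the_elem singletonD)
    then show "c \<alpha> = 0" using empty.prems(3) by simp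
  qed
next
  case (insert a A)
  show ?case
  proof
    fix \<gamma> assume \<gamma>: "\<gamma> \<in> F"
    define d where "d = \<gamma> a"
    define Fd where "Fd = {\<alpha>\<in>F. \<alpha> a = d}"
    have inj: "inj_on (\<lambda>\<alpha>. \<alpha>(a := 0)) Fd"
    proof (rule inj_onI)
      fix \<alpha> \<beta> assume *: "\<alpha> \<in> Fd" "\<beta> \<in> Fd" "\<alpha>(a := 0) = \<beta>(a := 0)"
      show "\<alpha> = \<beta>"
      proof
        fix i show "\<alpha> i = \<beta> i" using *(1,2) fun_cong[OF *(3), of i] by (cases "i = a") (auto simp: Fd_def)
      qed
    qed
    have coef: "(\<Sum>\<alpha>\<in>Fd. c \<alpha> * (\<Prod>i\<in>A. v i ^ \<alpha> i)) = 0" for v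
    proof -
      define q where "q = (\<Sum>\<alpha>\<in>F. monom (c \<alpha> * (\<Prod>i\<in>A. v i ^ \<alpha> i)) (\<alpha> a))"
      have "poly q t = 0" for t
      proof -
        have "(\<Prod>i\<in>A. (v(a := t)) i ^ \<alpha> i) = (\<Prod>i\<in>A. v i ^ \<alpha> i)" for \<alpha>
          using insert.hyps by (intro prod.cong) auto
        then have "poly q t = (\<Sum>\<alpha>\<in>F. c \<alpha> * (\<Prod>i\<in>insert a A. (v(a := t)) i ^ \<alpha> i))"
          using insert.hyps by (auto simp: q_def poly_sum poly_monom mult_ac intro!: sum.cong)
        then show ?thesis using insert.prems(3)[of "v(a := t)"] by simp
      qed
      then have "q = 0" using poly_all_0_iff_0 by blast
      then have "coeff q d = 0" by simp
      also have "coeff q d = (\<Sum>\<alpha>\<in>F. if \<alpha> a = d then c \<alpha> * (\<Prod>i\<in>A. v i ^ \<alpha> i) else 0)"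
        by (simp add: q_def coeff_sum)
      also have "\<dots> = (\<Sum>\<alpha>\<in>Fd. c \<alpha> * (\<Prod>i\<in>A. v i ^ \<alpha> i))"
        unfolding Fd_def using insert.prems(1) by (simp add: sum.inter_filter)
      finally show ?thesis .
    qed
    have "\<forall>\<beta>\<in>(\<lambda>\<alpha>. \<alpha>(a := 0)) ` Fd. c (\<beta>(a := d)) = 0"
    proof (rule insert.IH)
      show "finite ((\<lambda>\<alpha>. \<alpha>(a := 0)) ` Fd)" using insert.prems(1) by (simp add: Fd_def)
      show "\<beta> i = 0" if "\<beta> \<in> (\<lambda>\<alpha>. \<alpha>(a := 0)) ` Fd" "i \<notin> A" for \<beta> i
        using that insert.prems(2) by (auto simp: Fd_def)
      show "(\<Sum>\<beta>\<in>(\<lambda>\<alpha>. \<alpha>(a := 0)) ` Fd. c (\<beta>(a := d)) * (\<Prod>i\<in>A. v i ^ \<beta> i)) = 0" for v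
      proof -
        have "(\<Sum>\<beta>\<in>(\<lambda>\<alpha>. \<alpha>(a := 0)) ` Fd. c (\<beta>(a := d)) * (\<Prod>i\<in>A. v i ^ \<beta> i))
            = (\<Sum>\<alpha>\<in>Fd. c (\<alpha>(a := 0, a := d)) * (\<Prod>i\<in>A. v i ^ (\<alpha>(a := 0)) i))"
          by (simp add: sum.reindex[OF inj])
        also have "\<dots> = (\<Sum>\<alpha>\<in>Fd. c \<alpha> * (\<Prod>i\<in>A. v i ^ \<alpha> i))"
        proof (intro sum.cong refl)
          fix \<alpha> assume \<alpha>: "\<alpha> \<in> Fd"
          have "\<alpha>(a := 0, a := d) = \<alpha>" using \<alpha> by (auto simp: Fd_def)
          moreover have "(\<Prod>i\<in>A. v i ^ (\<alpha>(a := 0)) i) = (\<Prod>i\<in>A. v i ^ \<alpha> i)"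
            using insert.hyps by (intro prod.cong) auto
          ultimately show "c (\<alpha>(a := 0, a := d)) * (\<Prod>i\<in>A. v i ^ (\<alpha>(a := 0)) i)
              = c \<alpha> * (\<Prod>i\<in>A. v i ^ \<alpha> i)" by simp
        qed
        finally show ?thesis using coef by simp
      qed
    qed
    moreover have "\<gamma> \<in> Fd" "\<gamma>(a := d) = \<gamma>" using \<gamma> by (auto simp: Fd_def d_def)
    ultimately show "c \<gamma> = 0" by force
  qed
qed

text \<open>
  The order of the zero of \<open>q\<close> at the origin is at most its degree.
\<close>

lemma polynomial_bigo_eq_0:
  fixes q :: "complex poly"
  assumes q: "poly q \<in> O[at 0](\<lambda>t. t ^ m)" and deg: "degree q < m"
  shows "q = 0"
proof (rule ccontr)
  assume "q \<noteq> 0"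
  define k where "k = order 0 q"
  obtain r where r: "q = [:0, 1:] ^ k * r" "\<not> [:0, 1:] dvd r"
    using order_decomp[OF \<open>q \<noteq> 0\<close>, of 0] by (auto simp: k_def)
  have r0: "poly r 0 \<noteq> 0" using r(2) by (auto simp: dvd_iff_poly_eq_0)
  have km: "k < m" using order_degree[OF \<open>q \<noteq> 0\<close>, of 0] deg by (simp add: k_def)
  from q obtain C where C: "C > 0" "\<forall>\<^sub>F t in at 0. norm (poly q t) \<le> C * norm (t ^ m)"
    by (elim landau_o.bigE)
  have ne: "\<forall>\<^sub>F t::complex in at 0. t \<noteq> 0" by (simp add: eventually_at_filter)
  have "\<forall>\<^sub>F t in at 0. norm (poly r t) \<le> C * norm t ^ (m - k)"
    using C(2) ne
  proof eventually_elim
    case (elim t)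
    have "norm t ^ k * norm (poly r t) \<le> norm t ^ k * (C * norm t ^ (m - k))"
      using elim km by (simp add: r(1) norm_mult norm_power power_add[symmetric] mult.left_commute)
    then show ?case using elim by simp
  qed
  moreover have "((\<lambda>t. norm (poly r t)) \<longlongrightarrow> norm (poly r 0)) (at 0)"
    by (intro tendsto_intros)
  moreover have "((\<lambda>t::complex. C * norm t ^ (m - k)) \<longlongrightarrow> C * norm (0::complex) ^ (m - k)) (at 0)"
    by (intro tendsto_intros)
  ultimately have "norm (poly r 0) \<le> C * norm (0::complex) ^ (m - k)"
    by (intro tendsto_le[of "at (0::complex)"]) auto
  then show False using r0 km by (simp add: power_0_left)
qed

lemma laurent_diag_mult:
  assumes "\<exists>q. f \<in> laurent n q q" "\<exists>q. g \<in> laurent n q q"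
  shows "\<exists>q. (\<lambda>x. f x * g x) \<in> laurent n q q"
  using assms laurent_mult by blast

lemma laurent_diag_prod:
  "(\<And>i. i \<in> I \<Longrightarrow> \<exists>q. f i \<in> laurent n q q) \<Longrightarrow> \<exists>q. (\<lambda>x. \<Prod>i\<in>I. f i x) \<in> laurent n q q"
  by (induction I rule: infinite_finite_induct)
    (auto intro!: laurent_diag_mult laurent_const)

lemma laurent_diag_coord_diff_power:
  assumes "l \<le> n"
  shows "\<exists>q. (\<lambda>x. (x l - c) ^ k) \<in> laurent n q q"
proof -
  have "(\<lambda>x. x l - c) \<in> laurent n 1 1"
    by (intro laurent_diff laurent_const laurent_mono_le[OF laurent_coord[OF assms]]) auto
  then have "\<exists>q. (\<lambda>x. \<Prod>i<k. x l - c) \<in> laurent n q q"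
    by (intro laurent_diag_prod) auto
  then show ?thesis by simp
qed

lemma coord_diff_power_vanishing: "(\<lambda>x. (x l - b l) ^ m) \<in> vanishing {b} m"
  unfolding vanishing_def by (auto simp: power_mult_distrib)

text \<open>
  Meaningful only for points that differ at some index from \<open>1\<close> to \<open>n\<close>.
\<close>

definition sepcoord :: "nat \<Rightarrow> (nat \<Rightarrow> complex) \<Rightarrow> (nat \<Rightarrow> complex) \<Rightarrow> nat" where
  "sepcoord n a b = (SOME l. l \<in> {1..n} \<and> a l \<noteq> b l)"

text \<open>
  Nonzero at \<open>a\<close> and vanishing to order \<open>m\<close> at the other points of \<open>A\<close>.
\<close>

definition bump :: "(nat \<Rightarrow> complex) set \<Rightarrow> nat \<Rightarrow> nat \<Rightarrow> (nat \<Rightarrow> complex) \<Rightarrow> (nat \<Rightarrow> complex) \<Rightarrow> complex" where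
  "bump A n m a x = (\<Prod>b\<in>A-{a}. (x (sepcoord n a b) - b (sepcoord n a b)) ^ m)"

definition jet :: "nat \<Rightarrow> (nat \<Rightarrow> complex) \<Rightarrow> (nat \<Rightarrow> nat) \<Rightarrow> (nat \<Rightarrow> complex) \<Rightarrow> complex" where
  "jet n a \<alpha> x = (\<Prod>i=1..n. (x i - a i) ^ \<alpha> i)"

lemma jet_laurent: "\<exists>q. jet n a \<alpha> \<in> laurent n q q"
  unfolding jet_def by (intro laurent_diag_prod laurent_diag_coord_diff_power) auto

context
  fixes A :: "(nat \<Rightarrow> complex) set" and n :: nat
  assumes A: "finite A" "A \<subseteq> torus n"
    and sep: "\<And>a b. a \<in> A \<Longrightarrow> b \<in> A \<Longrightarrow> a \<noteq> b \<Longrightarrow> \<exists>l\<in>{1..n}. a l \<noteq> b l"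
begin

lemma sepcoord:
  assumes "a \<in> A" "b \<in> A" "a \<noteq> b"
  shows "sepcoord n a b \<le> n" "a (sepcoord n a b) \<noteq> b (sepcoord n a b)"
proof -
  have "\<exists>l. l \<in> {1..n} \<and> a l \<noteq> b l" using sep[OF assms] by blast
  from someI_ex[OF this] show "sepcoord n a b \<le> n" "a (sepcoord n a b) \<noteq> b (sepcoord n a b)"
    unfolding sepcoord_def by auto
qed

lemma bump_laurent: "a \<in> A \<Longrightarrow> \<exists>q. bump A n m a \<in> laurent n q q"
  unfolding bump_def by (intro laurent_diag_prod laurent_diag_coord_diff_power) (auto simp: sepcoord)

lemma bump_nonzero: "a \<in> A \<Longrightarrow> bump A n m a a \<noteq> 0"
  using A by (auto simp: bump_def sepcoord)

lemma bump_vanishing: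
  assumes ab: "a \<in> A" "b \<in> A" "a \<noteq> b"
  shows "bump A n m a \<in> vanishing {b} m"
proof -
  let ?f = "\<lambda>c x. (x (sepcoord n a c) - c (sepcoord n a c)) ^ m :: complex"
  have "\<exists>q. (\<lambda>x. \<Prod>c\<in>A-{a}-{b}. ?f c x) \<in> laurent n q q"
    using ab by (intro laurent_diag_prod laurent_diag_coord_diff_power) (auto simp: sepcoord)
  then have "(\<lambda>x. \<Prod>c\<in>A-{a}-{b}. ?f c x) \<in> vanishing {b} 0"
    using laurent_vanishing_0 A ab by blast
  from vanishing_mult[OF coord_diff_power_vanishing this, of "sepcoord n a b" m]
  show ?thesis unfolding bump_def using A ab by (subst prod.remove[of _ b]) auto
qed

text \<open>
  At a point \<open>b\<close> only the summands belonging to \<open>b\<close> survive modulo order \<open>m\<close>, and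
  the bump function there is invertible.  What remains on each line is a polynomial in \<open>t\<close> of
  degree less than \<open>m\<close> that is \<open>O(t ^ m)\<close>, hence zero; at \<open>t = 1\<close> this is a polynomial
  identity in the direction of the line.
\<close>

lemma bump_jet_independent:
  assumes m: "m > 0"
    and van: "(\<lambda>x. \<Sum>j\<in>A \<times> mexps {1..n} (m - 1). c j * (bump A n m (fst j) x * jet n (fst j) (snd j) x)) \<in> vanishing A m"
  shows "\<forall>j\<in>A \<times> mexps {1..n} (m - 1). c j = 0"
proof -
  let ?M = "mexps {1..n} (m - 1)"
  have "\<forall>\<alpha>\<in>?M. c (b, \<alpha>) = 0" if b: "b \<in> A" for b
  proof (rule multivariate_polynomial_eq_0[of "{1..n}"])
    show "finite {1..n}" "finite ?M" by simp_all
    show "\<alpha> i = 0" if "\<alpha> \<in> ?M" "i \<notin> {1..n}" for \<alpha> i using that by (simp add: mexps_def)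
    have bt: "b \<in> torus n" using b A by auto
    let ?T = "\<lambda>x. \<Sum>\<alpha>\<in>?M. c (b, \<alpha>) * jet n b \<alpha> x"
    let ?R = "\<lambda>a x. \<Sum>\<alpha>\<in>?M. c (a, \<alpha>) * (bump A n m a x * jet n a \<alpha> x)"
    have other: "?R a \<in> vanishing {b} m" if "a \<in> A - {b}" for a
    proof (intro vanishing_sum vanishing_scale)
      fix \<alpha>
      have "jet n a \<alpha> \<in> vanishing {b} 0" using jet_laurent laurent_vanishing_0 bt by blast
      from vanishing_mult[OF bump_vanishing this, of a m] that b
      show "(\<lambda>x. bump A n m a x * jet n a \<alpha> x) \<in> vanishing {b} m" by simp
    qed
    have "(\<lambda>x. \<Sum>a\<in>A. ?R a x) \<in> vanishing {b} m"
      using van b by (simp add: vanishing_def sum.cartesian_product case_prod_unfold)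
    moreover have "(\<lambda>x. \<Sum>a\<in>A-{b}. ?R a x) \<in> vanishing {b} m"
      by (rule vanishing_sum[OF other])
    ultimately have "(\<lambda>x. (\<Sum>a\<in>A. ?R a x) + - 1 * (\<Sum>a\<in>A-{b}. ?R a x)) \<in> vanishing {b} m"
      by (intro vanishing_add vanishing_scale)
    also have "(\<lambda>x. (\<Sum>a\<in>A. ?R a x) + - 1 * (\<Sum>a\<in>A-{b}. ?R a x)) = (\<lambda>x. bump A n m b x * ?T x)"
    proof
      fix x
      have "(\<Sum>a\<in>A. ?R a x) = ?R b x + (\<Sum>a\<in>A-{b}. ?R a x)"
        using A b by (intro sum.remove)
      moreover have "?R b x = bump A n m b x * ?T x" by (simp add: sum_distrib_left mult_ac)
      ultimately show "(\<Sum>a\<in>A. ?R a x) + - 1 * (\<Sum>a\<in>A-{b}. ?R a x) = bump A n m b x * ?T x"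
        by simp
    qed
    finally have bT: "(\<lambda>x. bump A n m b x * ?T x) \<in> vanishing {b} m" .
    fix v :: "nat \<Rightarrow> complex"
    define w where "w = v(0 := 0)"
    define q where "q = (\<Sum>\<alpha>\<in>?M. monom (c (b, \<alpha>) * (\<Prod>i=1..n. v i ^ \<alpha> i)) (sum \<alpha> {1..n}))"
    have q: "poly q t = ?T (\<lambda>i. b i + t * w i)" for t
    proof -
      have "jet n b \<alpha> (\<lambda>i. b i + t * w i) = t ^ sum \<alpha> {1..n} * (\<Prod>i=1..n. v i ^ \<alpha> i)" for \<alpha>
        by (simp add: jet_def w_def power_mult_distrib prod.distrib power_sum)
      then show ?thesis by (simp add: q_def poly_sum poly_monom mult_ac)
    qed
    let ?b = "\<lambda>t. bump A n m b (\<lambda>i. b i + t * w i)"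
    obtain k where "bump A n m b \<in> laurent n k k" using bump_laurent b by blast
    then have lim: "(?b \<longlongrightarrow> bump A n m b b) (at 0)"
      by (rule laurent_line_tendsto[OF _ bt]) (simp add: w_def)
    then have "((\<lambda>t. inverse (?b t)) \<longlongrightarrow> inverse (bump A n m b b)) (at 0)"
      by (rule tendsto_inverse) (rule bump_nonzero[OF b])
    then have inv: "(\<lambda>t. inverse (?b t)) \<in> O[at 0](\<lambda>t. t ^ 0)"
      by (intro bigoI_tendsto[where c = "inverse (bump A n m b b)"]) auto
    have "(\<lambda>t. ?b t * poly q t) \<in> O[at 0](\<lambda>t. t ^ m)"
      using bT by (simp add: vanishing_def q w_def)
    from landau_o.big.mult[OF inv this]
    have "(\<lambda>t. inverse (?b t) * (?b t * poly q t)) \<in> O[at 0](\<lambda>t. t ^ m)" by simp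
    moreover have "\<forall>\<^sub>F t in at 0. inverse (?b t) * (?b t * poly q t) = poly q t"
      using tendsto_imp_eventually_ne[OF lim bump_nonzero[OF b]] by eventually_elim simp
    ultimately have "poly q \<in> O[at 0](\<lambda>t. t ^ m)" by (simp cong: landau_o.big.in_cong)
    moreover have "degree q \<le> m - 1" unfolding q_def
      by (intro degree_sum_le finite_mexps order.trans[OF degree_monom_le]) (auto simp: mexps_def)
    ultimately have "q = 0" using m by (intro polynomial_bigo_eq_0) auto
    then have "poly q 1 = 0" by simp
    then show "(\<Sum>\<alpha>\<in>?M. c (b, \<alpha>) * (\<Prod>i=1..n. v i ^ \<alpha> i)) = 0"
      by (simp add: q_def poly_sum poly_monom)
  qed
  then show ?thesis by auto
qed

end

section \<open>Counting monomials and points\<close>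

lemma sum_Pow_card:
  fixes f :: "nat \<Rightarrow> nat"
  assumes "finite S"
  shows "(\<Sum>B\<in>Pow S. f (card B)) = (\<Sum>k\<le>card S. (card S choose k) * f k)"
proof -
  have "(\<Sum>B\<in>Pow S. f (card B)) = (\<Sum>k\<le>card S. \<Sum>B\<in>{B\<in>Pow S. card B = k}. f (card B))"
    using assms by (intro sum.group[symmetric]) (auto simp: card_mono)
  also have "\<dots> = (\<Sum>k\<le>card S. (card S choose k) * f k)"
    using n_subsets[OF assms] by (intro sum.cong) (auto simp: Pow_def)
  finally show ?thesis .
qed

text \<open>
  Splitting the indices into those with positive exponent and the rest bounds the number of
  exponents by a sum over \<open>k\<close> of \<open>n choose k\<close> times the numbers of monomials in \<open>k\<close>
  and in \<open>n - k\<close> variables.  The factor \<open>fact n\<close> turns the latter, up to powers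
  of \<open>K + n\<close>, into a second \<open>n choose k\<close>, and the squares sum to the central binomial coefficient.
\<close>

lemma card_exps_le: "card (exps n K K) * fact n \<le> ((2 * n) choose n) * (K + n) ^ n"
proof -
  let ?N = "{1..n}"
  let ?S = "SIGMA B:Pow ?N. mexps B K \<times> mexps (?N - B) K"
  let ?g = "\<lambda>(B, \<alpha>, \<beta>) i. if i \<in> B then int (\<alpha> i) else - int (\<beta> i)"
  have finB: "finite B" if "B \<in> Pow ?N" for B
    using that by (intro finite_subset[of B ?N]) auto
  have fin: "finite (mexps B K \<times> mexps (?N - B) K)" if "B \<in> Pow ?N" for B
    using finB[OF that] by simp
  have finS: "finite ?S" by (rule finite_SigmaI[OF _ fin]) simp
  have "exps n K K \<subseteq> ?g ` ?S"
  proof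
    fix e assume e: "e \<in> exps n K K"
    define B where "B = {i\<in>?N. e i > 0}"
    define \<alpha> where "\<alpha> i = nat (e i)" for i
    define \<beta> where "\<beta> i = nat (- e i)" for i
    have "sum \<alpha> B \<le> sum \<alpha> ?N" "sum \<beta> (?N - B) \<le> sum \<beta> ?N"
      by (intro sum_mono2; auto simp: B_def)+
    then have "sum \<alpha> B \<le> K" "sum \<beta> (?N - B) \<le> K"
      using e by (auto simp: exps_def \<alpha>_def \<beta>_def)
    moreover have "\<alpha> i = 0" if "i \<notin> B" for i
      using that e by (cases "i \<in> ?N") (auto simp: B_def \<alpha>_def exps_def)
    moreover have "\<beta> i = 0" if "i \<notin> ?N - B" for i
      using that e by (cases "i \<in> ?N") (auto simp: B_def \<beta>_def exps_def)
    ultimately have "(B, \<alpha>, \<beta>) \<in> ?S" by (auto simp: mexps_def B_def)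
    moreover have "e = ?g (B, \<alpha>, \<beta>)"
    proof
      fix i show "e i = ?g (B, \<alpha>, \<beta>) i"
        using e by (cases "i \<in> ?N") (auto simp: B_def \<alpha>_def \<beta>_def exps_def)
    qed
    ultimately show "e \<in> ?g ` ?S" by (rule rev_image_eqI)
  qed
  then have "card (exps n K K) \<le> card ?S" by (rule surj_card_le[OF finS])
  also have "card ?S = (\<Sum>B\<in>Pow ?N. card (mexps B K \<times> mexps (?N - B) K))"
    by (rule card_SigmaI) (use fin in blast)+
  also have "\<dots> = (\<Sum>B\<in>Pow ?N. ((K + card B) choose card B) * ((K + (n - card B)) choose (n - card B)))"
  proof (intro sum.cong refl)
    fix B assume B: "B \<in> Pow ?N"
    then have "card (?N - B) = n - card B" using finB by (subst card_Diff_subset) auto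
    then show "card (mexps B K \<times> mexps (?N - B) K)
        = ((K + card B) choose card B) * ((K + (n - card B)) choose (n - card B))"
      using finB[OF B] by (simp add: card_cartesian_product card_mexps)
  qed
  also have "\<dots> = (\<Sum>k\<le>n. (n choose k) * (((K + k) choose k) * ((K + (n - k)) choose (n - k))))"
    using sum_Pow_card[of ?N "\<lambda>k. ((K + k) choose k) * ((K + (n - k)) choose (n - k))"] by simp
  finally have "card (exps n K K) * fact n
      \<le> (\<Sum>k\<le>n. (n choose k) * (((K + k) choose k) * ((K + (n - k)) choose (n - k)))) * fact n"
    by (rule mult_right_mono) simp
  also have "\<dots> \<le> (\<Sum>k\<le>n. (n choose k)^2 * (K + n) ^ n)"
    unfolding sum_distrib_right
  proof (rule sum_mono)
    fix k assume "k \<in> {..n}"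
    then have k: "k \<le> n" by simp
    have 1: "((K + k) choose k) * fact k \<le> (K + n) ^ k"
      using binomial_fact_pow[of "K + k" k] power_mono[of "K + k" "K + n" k] k by linarith
    have 2: "((K + (n - k)) choose (n - k)) * fact (n - k) \<le> (K + n) ^ (n - k)"
      using binomial_fact_pow[of "K + (n - k)" "n - k"] power_mono[of "K + (n - k)" "K + n" "n - k"] k by linarith
    have "(n choose k) * (((K + k) choose k) * ((K + (n - k)) choose (n - k))) * fact n
      = (n choose k)^2 * ((((K + k) choose k) * fact k) * (((K + (n - k)) choose (n - k)) * fact (n - k)))"
      unfolding binomial_fact_lemma[OF k, symmetric] by (simp add: power2_eq_square mult_ac)
    also have "\<dots> \<le> (n choose k)^2 * ((K + n) ^ k * (K + n) ^ (n - k))"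
      by (intro mult_left_mono mult_mono 1 2) auto
    also have "(K + n) ^ k * (K + n) ^ (n - k) = (K + n) ^ n"
      using k by (simp flip: power_add)
    finally show "(n choose k) * (((K + k) choose k) * ((K + (n - k)) choose (n - k))) * fact n
      \<le> (n choose k)^2 * (K + n) ^ n" .
  qed
  also have "\<dots> = ((2 * n) choose n) * (K + n) ^ n"
    by (simp add: choose_square_sum[symmetric] sum_distrib_right)
  finally show ?thesis .
qed

lemma power_le_fact_choose:
  assumes "m > 0"
  shows "m ^ n \<le> ((m - 1 + n) choose n) * fact n"
proof (induction n)
  case (Suc n)
  have "m ^ Suc n \<le> (m + n) * (((m - 1 + n) choose n) * fact n)"
    using Suc by (auto intro: mult_mono)
  also have "m + n = Suc (m - 1 + n)" using assms by simp
  also have "\<dots> * (((m - 1 + n) choose n) * fact n) = (Suc (m - 1 + n) choose Suc n) * (Suc n * fact n)"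
    by (simp only: Suc_times_binomial_eq mult.assoc[symmetric])
  also have "\<dots> = ((m - 1 + Suc n) choose Suc n) * fact (Suc n)"
    by (simp only: fact_Suc add_Suc_right of_nat_id)
  finally show ?case .
qed auto

context prime_fourier
begin

text \<open>
  The two dimension estimates agree in the power \<open>m ^ n\<close>; the comparison of their leading
  coefficients is the assertion.
\<close>

lemma card_common_zeros_le:
  assumes A: "finite A" "A \<subseteq> torus n"
    and zero: "\<And>a i. a \<in> A \<Longrightarrow> i < 2 * p \<Longrightarrow> cfun i a = 0"
    and sep: "\<And>a b. a \<in> A \<Longrightarrow> b \<in> A \<Longrightarrow> a \<noteq> b \<Longrightarrow> \<exists>l\<in>{1..n}. a l \<noteq> b l"
  shows "card A \<le> (2 * n) choose n"
proof -
  define C where "C = (2 * n) choose n"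
  have key: "card A * m ^ n \<le> C * (m + (p + n)) ^ n" if m: "m > 0" for m
  proof -
    let ?I = "A \<times> mexps {1..n} (m - 1)"
    let ?G = "\<lambda>j x. bump A n m (fst j) x * jet n (fst j) (snd j) x"
    have fin: "finite ?I" using A by simp
    have G: "\<exists>q. ?G j \<in> laurent n q q" if "j \<in> ?I" for j
    proof (rule laurent_diag_mult[OF _ jet_laurent])
      show "\<exists>q. bump A n m (fst j) \<in> laurent n q q"
        by (rule bump_laurent[OF A sep]) (use that in auto)
    qed
    have "\<not> card (exps n (p + m) (p + m)) < card ?I"
    proof
      assume "card (exps n (p + m) (p + m)) < card ?I"
      then have "\<exists>c. (\<exists>j\<in>?I. c j \<noteq> 0) \<and> (\<lambda>x. \<Sum>j\<in>?I. c j * ?G j x) \<in> vanishing A m"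
        using fin G by (intro dependent_mod_vanishing[OF A(2) zero, where G = ?G]) auto
      then obtain c where
        c: "\<exists>j\<in>?I. c j \<noteq> 0" "(\<lambda>x. \<Sum>j\<in>?I. c j * ?G j x) \<in> vanishing A m" by blast
      have "\<forall>j\<in>?I. c j = 0"
        by (rule bump_jet_independent[OF A sep m, where c = c]) (assumption | rule c(2))+
      with c(1) show False by blast
    qed
    then have "card A * ((m - 1 + n) choose n) \<le> card (exps n (p + m) (p + m))"
      by (simp add: card_cartesian_product card_mexps)
    then have "card A * (((m - 1 + n) choose n) * fact n) \<le> card (exps n (p + m) (p + m)) * fact n"
      by (metis mult.assoc mult_le_mono1)
    also have "\<dots> \<le> C * (m + (p + n)) ^ n"
      using card_exps_le[of n "p + m"] by (simp add: C_def add_ac)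
    finally show ?thesis using power_le_fact_choose[OF m, of n]
      by (meson le_trans mult_le_mono2)
  qed
  have "(\<lambda>m. real C * (1 + real (p + n) / real m) ^ n) \<longlonglongrightarrow> real C * (1 + 0) ^ n"
    by (intro tendsto_intros lim_const_over_n)
  then have "real (card A) \<le> real C * (1 + 0) ^ n"
  proof (rule LIMSEQ_le_const, intro exI[of _ 1] allI impI)
    fix m :: nat assume m: "1 \<le> m"
    have "real (card A * m ^ n) \<le> real (C * (m + (p + n)) ^ n)"
      using key[of m] m by (simp only: of_nat_le_iff)
    then have "real (card A) * real m ^ n \<le> real C * (real m + real (p + n)) ^ n" by simp
    then have "real (card A) \<le> real C * (real m + real (p + n)) ^ n / real m ^ n"
      using m by (simp add: field_simps)
    also have "\<dots> = real C * (1 + real (p + n) / real m) ^ n"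
    proof -
      have "1 + real (p + n) / real m = (real m + real (p + n)) / real m"
        using m by (simp add: add_divide_distrib)
      then show ?thesis by (simp only: power_divide times_divide_eq_right)
    qed
    finally show "real (card A) \<le> real C * (1 + real (p + n) / real m) ^ n" .
  qed
  then show ?thesis by (simp add: C_def)
qed

end

section \<open>Circulant Hadamard matrices\<close>

text \<open>
  The default \<open>1\<close> ensures that two such functions can differ only at indices below \<open>p\<close>.
\<close>

definition first_column :: "nat \<Rightarrow> complex mat \<Rightarrow> nat \<Rightarrow> complex" where
  "first_column p H i = (if i < p then H $$ (i, 0) else 1)"

lemma circulant_entry:
  assumes "circulant p H" "j < p" "c < p"
  shows "H $$ (j, c) = H $$ (if c \<le> j then j - c else j + p - c, 0)"
proof -
  let ?r = "if c \<le> j then j - c else j + p - c"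
  have "[int j - int c = int ?r - int 0] (mod int p)"
  proof (cases "c \<le> j")
    case False
    then have "int j - int c - (int (j + p - c) - int 0) = - int p" using assms(3) by (simp add: of_nat_diff)
    then show ?thesis using False by (simp add: cong_iff_dvd_diff)
  qed (simp add: of_nat_diff)
  moreover have "?r < p" "0 < p" using assms(2,3) by auto
  ultimately show ?thesis using assms unfolding circulant_def by blast
qed

lemma circulant_eqI:
  assumes "circulant p H" "circulant p H'" "first_column p H = first_column p H'"
  shows "H = H'"
proof (rule eq_matI)
  have car: "H \<in> carrier_mat p p" "H' \<in> carrier_mat p p" using assms by (auto simp: circulant_def)
  then show "dim_row H = dim_row H'" "dim_col H = dim_col H'" by auto
  fix j c assume "j < dim_row H'" "c < dim_col H'"
  then have jc: "j < p" "c < p" using car by auto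
  define i where "i = (if c \<le> j then j - c else j + p - c)"
  have "i < p" using jc by (auto simp: i_def)
  then have "H $$ (i, 0) = H' $$ (i, 0)"
    using fun_cong[OF assms(3), of i] by (simp add: first_column_def)
  then show "H $$ (j, c) = H' $$ (j, c)"
    using circulant_entry[OF assms(1) jc] circulant_entry[OF assms(2) jc] by (simp add: i_def)
qed

lemma hadamard_column_product:
  assumes H: "complex_hadamard p H" and ac: "a < p" "c < p"
  shows "(\<Sum>j<p. cnj (H $$ (j, a)) * H $$ (j, c)) = (if a = c then of_nat p else 0)"
proof -
  have car: "H \<in> carrier_mat p p" using H by (simp add: complex_hadamard_def)
  have "(mat_adjoint H * H) $$ (a, c) = (of_nat p \<cdot>\<^sub>m 1\<^sub>m p) $$ (a, c)"
    using H by (simp add: complex_hadamard_def)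
  moreover have "(mat_adjoint H * H) $$ (a, c) = (\<Sum>j<p. cnj (H $$ (j, a)) * H $$ (j, c))"
    using ac car by (simp add: mat_adjoint_def scalar_prod_def lessThan_atLeast0)
  ultimately show ?thesis using ac by simp
qed

context prime_fourier
begin

text \<open>
  Row \<open>j\<close> of a circulant is its first column read backwards from position \<open>j\<close>, so
  indexing the Fourier sum by columns costs only a power of \<open>\<omega>\<close>.
\<close>

lemma first_column_fourier:
  assumes circ: "circulant p H" and j: "j < p"
  shows "inverse \<omega> ^ (k * j) * (\<Sum>l<p. \<omega> ^ (k * l) * H $$ (l, 0))
    = (\<Sum>c<p. inverse \<omega> ^ (k * c) * H $$ (j, c))"
proof -
  define r where "r c = (if c \<le> j then j - c else j + p - c)" for c
  have \<omega>0: "\<omega> \<noteq> 0" using \<omega> p_pos by (auto simp: power_0_left)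
  have "(\<Sum>c<p. inverse \<omega> ^ (k * c) * H $$ (j, c))
      = (\<Sum>l<p. inverse \<omega> ^ (k * j) * (\<omega> ^ (k * l) * H $$ (l, 0)))"
  proof (rule sum.reindex_bij_witness[of _ r r])
    fix c assume "c \<in> {..<p}"
    then have c: "c < p" by simp
    have "\<omega> ^ (k * j) = \<omega> ^ (k * r c) * \<omega> ^ (k * c)"
    proof (cases "c \<le> j")
      case True
      then show ?thesis by (simp add: r_def add_mult_distrib2[symmetric] flip: power_add)
    next
      case False
      have "\<omega> ^ (k * r c) * \<omega> ^ (k * c) = \<omega> ^ (k * (j + p))"
        using False c by (simp add: r_def add_mult_distrib2[symmetric] flip: power_add)
      also have "\<dots> = \<omega> ^ (k * j) * (\<omega> ^ p) ^ k"
        by (simp add: add_mult_distrib2 power_add mult.commute flip: power_mult)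
      finally show ?thesis using \<omega> by simp
    qed
    then have "inverse \<omega> ^ (k * c) = inverse \<omega> ^ (k * j) * \<omega> ^ (k * r c)"
      using \<omega>0 by (simp add: power_inverse field_simps)
    moreover have "H $$ (j, c) = H $$ (r c, 0)"
      using circulant_entry[OF circ j c] by (simp add: r_def)
    ultimately show "inverse \<omega> ^ (k * j) * (\<omega> ^ (k * r c) * H $$ (r c, 0)) = inverse \<omega> ^ (k * c) * H $$ (j, c)"
      by simp
  qed (use j in \<open>auto simp: r_def\<close>)
  then show ?thesis by (simp add: sum_distrib_left)
qed

text \<open>
  For a Fourier form, the preceding identity shows that the squared modulus of the coefficient is a combination
  of the inner products of column \<open>0\<close> with all columns, of which only the one with itself survives.
\<close>

lemma first_column_solution:
  assumes had: "complex_hadamard p H" and circ: "circulant p H" and i: "i < 2 * p"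
  shows "cfun i (first_column p H) = 0"
proof -
  let ?x = "first_column p H"
  have x: "?x l = H $$ (l, 0)" if "l < p" for l using that by (simp add: first_column_def)
  have norm: "cmod (H $$ (l, 0)) = 1" if "l < p" for l
    using had that p_pos by (auto simp: complex_hadamard_def)
  have inv: "inverse (H $$ (l, 0)) = cnj (H $$ (l, 0))" if "l < p" for l
    using norm[OF that] by (simp add: inverse_complex_def complex_eq_iff cmod_def)
  show ?thesis
  proof (cases "i < p")
    case True
    then have "aform i ?x = ?x i" "bform i ?x = inverse (?x i)"
      by (simp_all add: aform_def bform_def form_def if_distrib[of "\<lambda>z. z * _"] cong: if_cong)
    moreover have "?x i \<noteq> 0" using norm[OF True] x[OF True] by auto
    ultimately show ?thesis using True by (simp add: cfun_def \<kappa>_def)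
  next
    case False
    define k where "k = i - p"
    have a: "aform i ?x = (\<Sum>l<p. \<omega> ^ (k * l) * H $$ (l, 0))"
      unfolding aform_def using False by (intro sum.cong) (auto simp: form_def k_def x)
    have b: "bform i ?x = (\<Sum>j<p. inverse \<omega> ^ (k * j) * cnj (H $$ (j, 0)))"
      unfolding bform_def using False by (intro sum.cong) (auto simp: form_def k_def x inv)
    have "aform i ?x * bform i ?x
        = (\<Sum>j<p. cnj (H $$ (j, 0)) * (inverse \<omega> ^ (k * j) * (\<Sum>l<p. \<omega> ^ (k * l) * H $$ (l, 0))))"
      unfolding b a[symmetric] sum_distrib_left by (simp add: mult_ac)
    also have "\<dots> = (\<Sum>j<p. cnj (H $$ (j, 0)) * (\<Sum>c<p. inverse \<omega> ^ (k * c) * H $$ (j, c)))"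
      by (intro sum.cong refl) (simp add: first_column_fourier[OF circ])
    also have "\<dots> = (\<Sum>c<p. inverse \<omega> ^ (k * c) * (\<Sum>j<p. cnj (H $$ (j, 0)) * H $$ (j, c)))"
      unfolding sum_distrib_left by (subst sum.swap) (simp add: mult_ac)
    also have "\<dots> = (\<Sum>c<p. if c = 0 then of_nat p else 0)"
      using p_pos by (intro sum.cong refl) (simp add: hadamard_column_product[OF had])
    also have "\<dots> = of_nat p" using p_pos by simp
    finally show ?thesis using False by (simp add: cfun_def \<kappa>_def)
  qed
qed

end

theorem mainTheorem4:
  fixes p :: nat
  assumes "prime p"
  shows "finite {H. complex_hadamard p H \<and> circulant p H \<and> (\<forall>j<p. H $$ (j, j) = 1)} \<and>
         card {H. complex_hadamard p H \<and> circulant p H \<and> (\<forall>j<p. H $$ (j, j) = 1)}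
           \<le> (2 * p - 2) choose (p - 1)"
proof (rule finite_if_finite_subsets_card_bdd)
  have "\<not> {z::complex. z ^ p = 1} \<subseteq> {1}"
  proof
    assume "{z::complex. z ^ p = 1} \<subseteq> {1}"
    then have "card {z::complex. z ^ p = 1} \<le> card {1::complex}" by (intro card_mono) auto
    then show False
      using card_roots_unity_eq[OF prime_gt_0_nat[OF assms]] prime_ge_2_nat[OF assms] by simp
  qed
  then obtain \<omega> :: complex where "\<omega> ^ p = 1" "\<omega> \<noteq> 1" by auto
  then interpret prime_fourier p \<omega> using assms by unfold_locales
  fix F assume F: "F \<subseteq> {H. complex_hadamard p H \<and> circulant p H \<and> (\<forall>j<p. H $$ (j, j) = 1)}" "finite F"
  have "inj_on (first_column p) F" 
  proof (rule inj_onI)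
    fix H H' assume "H \<in> F" "H' \<in> F" "first_column p H = first_column p H'"
    then show "H = H'" using F(1) by (intro circulant_eqI[of p]) auto
  qed
  then have "card F = card (first_column p ` F)" by (simp add: card_image)
  also have "\<dots> \<le> (2 * n) choose n"
  proof (rule card_common_zeros_le)
    show tor: "first_column p ` F \<subseteq> torus n"
    proof (rule image_subsetI)
      fix H assume H: "H \<in> F"
      then have "cmod (first_column p H i) = 1" for i
        using F p_pos by (auto simp: complex_hadamard_def first_column_def)
      then have "first_column p H i \<noteq> 0" for i by (metis norm_zero zero_neq_one)
      moreover have "first_column p H 0 = 1" using F H p_pos by (auto simp: first_column_def)
      ultimately show "first_column p H \<in> torus n" by (simp add: torus_def)
    qed
    show "\<exists>l\<in>{1..n}. a l \<noteq> b l"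
      if ab: "a \<in> first_column p ` F" "b \<in> first_column p ` F" "a \<noteq> b" for a b
    proof -
      obtain l where l: "a l \<noteq> b l" using ab(3) by auto
      have "a 0 = 1" "b 0 = 1" using ab tor by (auto simp: torus_def)
      then have "l \<noteq> 0" using l by metis
      moreover have "l < p" using l ab by (auto simp: first_column_def split: if_splits)
      ultimately show ?thesis using l by (intro bexI[of _ l]) (auto simp: le_n_iff)
    qed
    show "finite (first_column p ` F)" using F(2) by simp
    show "cfun i a = 0" if "a \<in> first_column p ` F" "i < 2 * p" for a i
    proof -
      from that(1) obtain H where "H \<in> F" "a = first_column p H" by blast
      with F(1) that(2) show ?thesis by (auto intro: first_column_solution)
    qed
  qed
  finally show "card F \<le> (2 * p - 2) choose (p - 1)" by (simp add: n_def diff_mult_distrib2)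
qed

end
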